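(* For $P=(h_0,h_1,u_0,u_1,l_0,l_1)\in\{M,V\}^6$ and $k\ge2$ put $C_P(k):=|F(P,k)|$. With $M=+1$, $V=-1$, set $\rho=h_0h_1$, $\tau=u_0u_1$, $\delta_i=h_0h_1u_il_i$ ($i=0,1$). Then for every $k\ge2$, $$C_P(k)=\begin{cases}0,&\delta_0\ne-1\text{ or }\delta_1\ne-1,\\ 1,&\delta_0=\delta_1=-1,\ \tau=-1,\\ 6k-5,&\delta_0=\delta_1=-1,\ \tau=+1,\ \rho=+1,\\ 4k-3,&\delta_0=\delta_1=-1,\ \tau=+1,\ \rho=-1.\end{cases}$$
   Context: Map and assignment. Let $k\ge2$, $n=2k$. The upper faces are $A_1,\dots,A_n$, the lower faces $B_1,\dots,B_n$. The creases are $H_c=(A_c,B_c)$ ($1\le c\le n$), $U_i=(A_i,A_{i+1})$ and $L_i=(B_i,B_{i+1})$ ($1\le i\le n-1$); the two faces of a crease are its wings. A word $P=(h_0,h_1,u_0,u_1,l_0,l_1)\in\{M,V\}^6$ assigns to $H_c$ the label $h_{(c-1)\bmod 2}$ and to $U_i,L_i$ the labels $u_{(i-1)\bmod2},l_{(i-1)\bmod2}$. The assignment is locally flat-foldable if for every $1\le c\le n-1$ an odd number of the four creases $H_c,H_{c+1},U_c,L_c$ (meeting at an interior vertex) are labelled $M$. States. $x\prec y$ means $x$ lies above (comes before) $y$ in a total order. A strict total order of all $4k$ labelled faces is order-valid for $P$ if: (i) Precedence: with $A_c$ in row $r=0$ and $B_c$ in row $r=1$, the face in row $r$, column $c$ is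 light-up iff $r+c-1$ is even and dark-up otherwise; across each $M$ crease the light-up wing precedes the dark-up wing, across each $V$ crease the dark-up wing precedes the light-up wing. (ii) Noncrossing: every $H_c$ has target class $S$; $U_i$ and $L_i$ have class $E$ for $i$ odd and $W$ for $i$ even; for any two distinct creases of the same target class with disjoint wing sets, with wing positions $a_0<a_1$ and $b_0<b_1$ in the order, neither $a_0<b_0<a_1<b_1$ nor $b_0<a_0<b_1<a_1$. $F(P,k)$ is the set of all order-valid strict total orders if $P$ is locally flat-foldable, and $F(P,k)=\varnothing$ otherwise. Faces are labelled; no symmetry quotient is taken. *)

theory Defs
  imports Main
begin

datatype mv = Mountain | Valley

datatype face = Upper nat | Lower nat

datatype crease = Hor nat | Up nat | Low nat

datatype target_class = South | East | West

text \<open>The map has the \<open>2k\<close> columns \<open>1, \<dots>, 2k\<close>: \<open>Upper c\<close> is \<open>A\<^sub>c\<close>, \<open>Lower c\<close> is \<open>B\<^sub>c\<close>,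
  and \<open>Hor c\<close>, \<open>Up i\<close>, \<open>Low i\<close> are the creases \<open>H\<^sub>c\<close>, \<open>U\<^sub>i\<close>, \<open>L\<^sub>i\<close>.\<close>

definition faces :: "nat \<Rightarrow> face set" where
  "faces k = Upper ` {1..2*k} \<union> Lower ` {1..2*k}"

definition creases :: "nat \<Rightarrow> crease set" where
  "creases k = Hor ` {1..2*k} \<union> Up ` {1..2*k-1} \<union> Low ` {1..2*k-1}"

fun wings :: "crease \<Rightarrow> face set" where
  "wings (Hor c) = {Upper c, Lower c}"
| "wings (Up i) = {Upper i, Upper (i+1)}"
| "wings (Low i) = {Lower i, Lower (i+1)}"

text \<open>The arguments are \<open>h\<^sub>0, h\<^sub>1, u\<^sub>0, u\<^sub>1, l\<^sub>0, l\<^sub>1\<close> in this order.\<close>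

datatype mv_word = Word mv mv mv mv mv mv

text \<open>Crease indices start at 1, so the truncated subtractions below are exact on the map.\<close>

fun crease_label :: "mv_word \<Rightarrow> crease \<Rightarrow> mv" where
  "crease_label (Word h0 h1 u0 u1 l0 l1) (Hor c) = [h0, h1] ! ((c - 1) mod 2)"
| "crease_label (Word h0 h1 u0 u1 l0 l1) (Up i) = [u0, u1] ! ((i - 1) mod 2)"
| "crease_label (Word h0 h1 u0 u1 l0 l1) (Low i) = [l0, l1] ! ((i - 1) mod 2)"

definition locally_flat_foldable :: "mv_word \<Rightarrow> nat \<Rightarrow> bool" where
  "locally_flat_foldable P k \<longleftrightarrow>
     (\<forall>c\<in>{1..2*k-1}.
        odd (card {e \<in> {Hor c, Hor (c+1), Up c, Low c}. crease_label P e = Mountain}))"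

fun light_up :: "face \<Rightarrow> bool" where
  "light_up (Upper c) = even (0 + c - 1)"
| "light_up (Lower c) = even (1 + c - 1)"

fun target :: "crease \<Rightarrow> target_class" where
  "target (Hor c) = South"
| "target (Up i) = (if odd i then East else West)"
| "target (Low i) = (if odd i then East else West)"

text \<open>An order is given by its strict relation \<open>R\<close>, where \<open>(x, y) \<in> R\<close> means that \<open>x\<close> lies above
  \<open>y\<close>.\<close>

definition precedence :: "mv_word \<Rightarrow> nat \<Rightarrow> (face \<times> face) set \<Rightarrow> bool" where
  "precedence P k R \<longleftrightarrow>
     (\<forall>e\<in>creases k. \<forall>x\<in>wings e. \<forall>y\<in>wings e. light_up x \<and> \<not> light_up y \<longrightarrow>
        (case crease_label P e of Mountain \<Rightarrow> (x, y) \<in> R | Valley \<Rightarrow> (y, x) \<in> R))"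

definition noncrossing :: "nat \<Rightarrow> (face \<times> face) set \<Rightarrow> bool" where
  "noncrossing k R \<longleftrightarrow>
     (\<forall>e\<in>creases k. \<forall>f\<in>creases k.
        e \<noteq> f \<and> target e = target f \<and> wings e \<inter> wings f = {} \<longrightarrow>
        (\<forall>a0 a1 b0 b1. wings e = {a0, a1} \<and> wings f = {b0, b1} \<and> (a0, a1) \<in> R \<and> (b0, b1) \<in> R \<longrightarrow>
           \<not> ((a0, b0) \<in> R \<and> (b0, a1) \<in> R \<and> (a1, b1) \<in> R) \<and>
           \<not> ((b0, a0) \<in> R \<and> (a0, b1) \<in> R \<and> (b1, a1) \<in> R)))"

text \<open>\<^const>\<open>strict_linear_order_on\<close> does not confine the relation to its carrier; the inclusion in
  the square of the carrier makes each total order correspond to exactly one relation.\<close>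

definition order_valid :: "mv_word \<Rightarrow> nat \<Rightarrow> (face \<times> face) set \<Rightarrow> bool" where
  "order_valid P k R \<longleftrightarrow>
     R \<subseteq> faces k \<times> faces k \<and> strict_linear_order_on (faces k) R \<and>
     precedence P k R \<and> noncrossing k R"

definition foldings :: "mv_word \<Rightarrow> nat \<Rightarrow> (face \<times> face) set set" where
  "foldings P k = (if locally_flat_foldable P k then {R. order_valid P k R} else {})"

definition folding_count :: "mv_word \<Rightarrow> nat \<Rightarrow> nat" where
  "folding_count P k = card (foldings P k)"

lemma finite_foldings: "finite (foldings P k)"
proof -
  have "finite (faces k)" by (simp add: faces_def)
  moreover have "foldings P k \<subseteq> Pow (faces k \<times> faces k)"
    by (auto simp: foldings_def order_valid_def)
  ultimately show ?thesis by (meson finite_Pow_iff finite_SigmaI finite_subset)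
qed

fun mv_sign :: "mv \<Rightarrow> int" where
  "mv_sign Mountain = 1"
| "mv_sign Valley = -1"

fun rho :: "mv_word \<Rightarrow> int" where
  "rho (Word h0 h1 u0 u1 l0 l1) = mv_sign h0 * mv_sign h1"

fun tau :: "mv_word \<Rightarrow> int" where
  "tau (Word h0 h1 u0 u1 l0 l1) = mv_sign u0 * mv_sign u1"

fun delta0 :: "mv_word \<Rightarrow> int" where
  "delta0 (Word h0 h1 u0 u1 l0 l1) = mv_sign h0 * mv_sign h1 * mv_sign u0 * mv_sign l0"

fun delta1 :: "mv_word \<Rightarrow> int" where
  "delta1 (Word h0 h1 u0 u1 l0 l1) = mv_sign h0 * mv_sign h1 * mv_sign u1 * mv_sign l1"

end

theory Submission
  imports Defs
begin

text \<open>If \<open>\<tau> = -1\<close>, the precedence constraints form a chain through all faces. Otherwise each row is a pleat: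
  its odd columns lie above the adjacent even ones (up to symmetry). Let column \<open>2m + 1\<close> carry the
  topmost face of a row, its apex. Working outwards from the apex, noncrossing of the edges of the row
  fixes the order of the columns to its left and of the columns to its right, and it forbids the
  two blocks to interleave, so that a row is coded by \<open>m\<close> and a bit telling which block comes
  first. The noncrossing horizontal creases then determine how the two rows are merged. For
  \<open>\<rho> = -1\<close> the horizontal crease at the apex encloses everything, so both rows have the same apex and
  their bits are free: \<open>1 + 4(k-1)\<close> codes. For \<open>\<rho> = 1\<close> two codes are compatible iff they are equal or the
  upper one is one of the two full spirals \<open>(0, True)\<close>, \<open>(k - 1, True)\<close>: \<open>(2k-3) + 2(2k-1)\<close> codes.\<close>

section \<open>Heights of the faces\<close>

text \<open>What fixes the merge of the two rows is that, for two noncrossing intervals, comparing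
  the start of one with the end of the other reduces to start-start and end-end comparisons. For
  \<open>rho = -1\<close> the normalised horizontal creases all start in the upper row and end in
  the lower one, so every comparison between the rows reduces to comparisons inside a row. For
  \<open>rho = 1\<close> the odd columns start above and the even columns below; two columns of
  different parity whose creases overlap may then be nested in either way. Equal codes exclude this
  ambiguity, and a spiral in the upper row decides it, because a spiral is one single nest.
  Symmetries of the words leave four representatives, one for each pair of signs \<open>rho\<close>,
  \<open>tau\<close>. Integer heights instead of abstract orders turn the conditions into linear
  inequalities and allow explicit witnesses.\<close>

definition stacking :: "nat \<Rightarrow> (face \<Rightarrow> int) \<Rightarrow> (face \<times> face) set" where
  "stacking k p = {(u, v). u \<in> faces k \<and> v \<in> faces k \<and> p u < p v}"

text \<open>Splitting the columns by parity removes all parity conditions: \<open>x i, y i, z i, w i\<close> are the heights of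
  \<open>A\<^sub>2\<^sub>i\<^sub>+\<^sub>1\<close>, \<open>A\<^sub>2\<^sub>i\<^sub>+\<^sub>2\<close>, \<open>B\<^sub>2\<^sub>i\<^sub>+\<^sub>1\<close>, \<open>B\<^sub>2\<^sub>i\<^sub>+\<^sub>2\<close> for \<open>i < k\<close>; smaller heights lie above larger ones.\<close>

fun heights :: "(nat \<Rightarrow> int) \<Rightarrow> (nat \<Rightarrow> int) \<Rightarrow> (nat \<Rightarrow> int) \<Rightarrow> (nat \<Rightarrow> int) \<Rightarrow> face \<Rightarrow> int" where
  "heights x y z w (Upper c) = (if odd c then x (c div 2) else y (c div 2 - 1))"
| "heights x y z w (Lower c) = (if odd c then z (c div 2) else w (c div 2 - 1))"

text \<open>\<open>nc a b c d\<close> is meaningful only for \<open>a \<le> b\<close> and \<open>c \<le> d\<close>; \<open>ncu\<close> sorts the endpoints first. Both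
  hold when the intervals share an endpoint, so equal or adjacent creases need no exception.\<close>

definition nc :: "int \<Rightarrow> int \<Rightarrow> int \<Rightarrow> int \<Rightarrow> bool" where
  "nc a b c d \<longleftrightarrow> \<not> (a < c \<and> c < b \<and> b < d) \<and> \<not> (c < a \<and> a < d \<and> d < b)"

definition ncu :: "int \<Rightarrow> int \<Rightarrow> int \<Rightarrow> int \<Rightarrow> bool" where
  "ncu a b c d \<longleftrightarrow> nc (min a b) (max a b) (min c d) (max c d)"

text \<open>The first line of conjuncts is the class South, split by the parities of the two
  columns; the second is the class East and the last group the class West. Mixed pairs occur in one
  order only, since \<open>ncu\<close> is symmetric in its two intervals.\<close>

definition laminar :: "nat \<Rightarrow> (nat \<Rightarrow> int) \<Rightarrow> (nat \<Rightarrow> int) \<Rightarrow> (nat \<Rightarrow> int) \<Rightarrow> (nat \<Rightarrow> int) \<Rightarrow> bool" where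
  "laminar k x y z w \<longleftrightarrow>
     (\<forall>i<k. \<forall>j<k.
        ncu (x i) (z i) (x j) (z j) \<and> ncu (y i) (w i) (y j) (w j) \<and> ncu (x i) (z i) (y j) (w j) \<and>
        ncu (x i) (y i) (x j) (y j) \<and> ncu (z i) (w i) (z j) (w j) \<and> ncu (x i) (y i) (z j) (w j)) \<and>
     (\<forall>i j. Suc i < k \<longrightarrow> Suc j < k \<longrightarrow>
        ncu (x (Suc i)) (y i) (x (Suc j)) (y j) \<and> ncu (z (Suc i)) (w i) (z (Suc j)) (w j) \<and>
        ncu (x (Suc i)) (y i) (z (Suc j)) (w j))"

fun precedes :: "mv \<Rightarrow> int \<Rightarrow> int \<Rightarrow> bool" where
  "precedes Mountain a b \<longleftrightarrow> a < b"
| "precedes Valley a b \<longleftrightarrow> b < a"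

text \<open>The light-up faces are those with heights \<open>x\<close> and \<open>w\<close>; they
  stand first in every \<open>precedes\<close>.\<close>

fun directed :: "mv_word \<Rightarrow> nat \<Rightarrow> (nat \<Rightarrow> int) \<Rightarrow> (nat \<Rightarrow> int) \<Rightarrow> (nat \<Rightarrow> int) \<Rightarrow> (nat \<Rightarrow> int) \<Rightarrow> bool" where
  "directed (Word h0 h1 u0 u1 l0 l1) k x y z w \<longleftrightarrow>
     (\<forall>i<k. precedes h0 (x i) (z i) \<and> precedes h1 (w i) (y i) \<and>
            precedes u0 (x i) (y i) \<and> precedes l0 (w i) (z i)) \<and>
     (\<forall>i. Suc i < k \<longrightarrow> precedes u1 (x (Suc i)) (y i) \<and> precedes l1 (w i) (z (Suc i)))"

section \<open>Quantifiers over columns, edges, faces and creases, split by column parity\<close>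

lemma ball_columns:
  "(\<forall>c\<in>{1..2*k}. Q c) \<longleftrightarrow> (\<forall>i<k. Q (Suc (2*i)) \<and> Q (Suc (Suc (2*i))))" (is "?L = ?R")
proof
  assume R: ?R
  show ?L
  proof
    fix c assume c: "c \<in> {1..2*k}"
    show "Q c"
    proof (cases "odd c")
      case True
      then obtain i where "c = Suc (2*i)" by (auto elim: oddE)
      with R c show ?thesis by auto
    next
      case False
      then obtain i where "c = 2*i" by (auto elim: evenE)
      with c obtain j where "c = Suc (Suc (2*j))" by (cases i) auto
      with R c show ?thesis by auto
    qed
  qed
qed auto

lemma ball_edges:
  "(\<forall>c\<in>{1..2*k-1}. Q c) \<longleftrightarrow>
     (\<forall>i<k. Q (Suc (2*i))) \<and> (\<forall>i. Suc i < k \<longrightarrow> Q (Suc (Suc (2*i))))" (is "?L = ?R")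
proof
  assume R: ?R
  show ?L
  proof
    fix c assume c: "c \<in> {1..2*k-1}"
    show "Q c"
    proof (cases "odd c")
      case True
      then obtain i where "c = Suc (2*i)" by (auto elim: oddE)
      with R c show ?thesis by auto
    next
      case False
      then obtain i where "c = 2*i" by (auto elim: evenE)
      with c obtain j where "c = Suc (Suc (2*j))" by (cases i) auto
      with R c show ?thesis by auto
    qed
  qed
qed auto

lemma ball_faces:
  "(\<forall>u\<in>faces k. Q u) \<longleftrightarrow> (\<forall>i<k. Q (Upper (Suc (2*i))) \<and> Q (Upper (Suc (Suc (2*i)))) \<and>
     Q (Lower (Suc (2*i))) \<and> Q (Lower (Suc (Suc (2*i)))))"
proof -
  have "(\<forall>u\<in>faces k. Q u) \<longleftrightarrow> (\<forall>c\<in>{1..2*k}. Q (Upper c) \<and> Q (Lower c))"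
    unfolding faces_def by blast
  then show ?thesis unfolding ball_columns by blast
qed

lemma ball_creases:
  "(\<forall>e\<in>creases k. Q e) \<longleftrightarrow>
     (\<forall>i<k. Q (Hor (Suc (2*i))) \<and> Q (Hor (Suc (Suc (2*i)))) \<and> Q (Up (Suc (2*i))) \<and> Q (Low (Suc (2*i)))) \<and>
     (\<forall>i. Suc i < k \<longrightarrow> Q (Up (Suc (Suc (2*i)))) \<and> Q (Low (Suc (Suc (2*i)))))"
proof -
  have "(\<forall>e\<in>creases k. Q e) \<longleftrightarrow>
      (\<forall>c\<in>{1..2*k}. Q (Hor c)) \<and> (\<forall>c\<in>{1..2*k-1}. Q (Up c) \<and> Q (Low c))"
    unfolding creases_def by blast
  then show ?thesis unfolding ball_columns ball_edges by blast
qed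

lemma face_mem [simp]:
  "Upper (Suc (2*i)) \<in> faces k \<longleftrightarrow> i < k" "Upper (Suc (Suc (2*i))) \<in> faces k \<longleftrightarrow> i < k"
  "Lower (Suc (2*i)) \<in> faces k \<longleftrightarrow> i < k" "Lower (Suc (Suc (2*i))) \<in> faces k \<longleftrightarrow> i < k"
  by (auto simp: faces_def)

lemma wings_subset_faces: "e \<in> creases k \<Longrightarrow> wings e \<subseteq> faces k"
proof -
  have "\<forall>e\<in>creases k. wings e \<subseteq> faces k"
    unfolding ball_creases by (auto simp: numeral_2_eq_2 simp flip: mult_Suc_right) (auto simp: faces_def)
  then show "e \<in> creases k \<Longrightarrow> wings e \<subseteq> faces k" by blast
qed

lemma card_wings: "card (wings e) = 2"
  by (cases e) (auto simp: card_insert_if)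

section \<open>Linear orders as injective height functions\<close>

lemma strict_linear_order_stacking:
  "inj_on p (faces k) \<Longrightarrow> strict_linear_order_on (faces k) (stacking k p)"
  by (auto simp: strict_linear_order_on_def stacking_def trans_def irrefl_def total_on_def inj_on_def
      dest: linorder_neqE)

lemma stacking_of_strict_linear_order:
  assumes R: "R \<subseteq> faces k \<times> faces k" and lin: "strict_linear_order_on (faces k) R"
  obtains p where "inj_on p (faces k)" "R = stacking k p"
proof
  let ?p = "\<lambda>u. int (card {v. (v, u) \<in> R})"
  have fin: "finite {v. (v, u) \<in> R}" for u
    by (rule finite_subset[of _ "faces k"]) (use R in \<open>auto simp: faces_def\<close>)
  have tr: "trans R" and irr: "irrefl R" and tot: "total_on (faces k) R"
    using lin by (auto simp: strict_linear_order_on_def)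
  have less: "?p u < ?p v" if "(u, v) \<in> R" for u v
  proof -
    have "{t. (t, u) \<in> R} \<subset> {t. (t, v) \<in> R}"
      using that tr irr by (auto simp: irrefl_def dest: transD)
    then show ?thesis using fin by (simp add: psubset_card_mono)
  qed
  show "inj_on ?p (faces k)"
    by (rule inj_onI) (metis less less_irrefl tot total_on_def)
  have "(u, v) \<in> R" if "u \<in> faces k" "v \<in> faces k" "?p u < ?p v" for u v
    using that less[of v u] tot by (metis less_irrefl less_asym total_on_def)
  then show "R = stacking k ?p"
    using R less by (auto simp: stacking_def)
qed

lemma heights_of: "\<exists>x y z w. \<forall>u\<in>faces k. heights x y z w u = p u"
proof (intro exI)
  show "\<forall>u\<in>faces k. heights (\<lambda>i. p (Upper (Suc (2*i)))) (\<lambda>i. p (Upper (Suc (Suc (2*i)))))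
      (\<lambda>i. p (Lower (Suc (2*i)))) (\<lambda>i. p (Lower (Suc (Suc (2*i))))) u = p u"
    unfolding ball_faces by simp
qed

lemma stacking_cong: "(\<And>u. u \<in> faces k \<Longrightarrow> p u = q u) \<Longrightarrow> stacking k p = stacking k q"
  by (auto simp: stacking_def)

lemma stacking_heights:
  assumes "R \<subseteq> faces k \<times> faces k" "strict_linear_order_on (faces k) R"
  obtains x y z w where "inj_on (heights x y z w) (faces k)" "R = stacking k (heights x y z w)"
proof -
  obtain p where p: "inj_on p (faces k)" "R = stacking k p"
    using stacking_of_strict_linear_order assms by blast
  obtain x y z w where h: "\<forall>u\<in>faces k. heights x y z w u = p u" using heights_of by blast
  show thesis
    by (rule that[of x y z w]) (use p h in \<open>auto simp: inj_on_def cong: stacking_cong\<close>)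
qed

lemma precedence_stacking:
  "precedence P k (stacking k (heights x y z w)) \<longleftrightarrow> directed P k x y z w"
proof (cases P)
  case (Word h0 h1 u0 u1 l0 l1)
  have [simp]: "(case m of Mountain \<Rightarrow> a < b | Valley \<Rightarrow> b < a) \<longleftrightarrow> precedes m a b" for m a b
    by (cases m) auto
  have [simp]: "Suc (Suc (Suc (2 * i))) = Suc (2 * Suc i)" for i by simp
  show ?thesis
    unfolding precedence_def ball_creases Word
    by (simp add: stacking_def del: mult_Suc_right cong: mv.case_cong)
qed

section \<open>Noncrossing as a condition on intervals of heights\<close>

definition span :: "(face \<Rightarrow> int) \<Rightarrow> crease \<Rightarrow> int \<times> int" where
  "span p e = (Min (p ` wings e), Max (p ` wings e))"

definition unlinked :: "int \<times> int \<Rightarrow> int \<times> int \<Rightarrow> bool" where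
  "unlinked s t \<longleftrightarrow> nc (fst s) (snd s) (fst t) (snd t)"

lemma unlinked_commute: "unlinked s t \<longleftrightarrow> unlinked t s"
  unfolding unlinked_def nc_def by auto

lemma noncrossing_spans:
  assumes inj: "inj_on p (faces k)"
  shows "noncrossing k (stacking k p) \<longleftrightarrow>
    (\<forall>e\<in>creases k. \<forall>f\<in>creases k. target e = target f \<longrightarrow> unlinked (span p e) (span p f))"
    (is "_ \<longleftrightarrow> ?R")
proof -
  have span: "span p e = (p a, p b)"
    if "wings e = {a, b}" "(a, b) \<in> stacking k p" for e a b
    using that by (auto simp: span_def stacking_def)
  have ordered: "\<exists>a b. wings e = {a, b} \<and> (a, b) \<in> stacking k p" if e: "e \<in> creases k" for e
  proof -
    obtain a b where ab: "wings e = {a, b}" "a \<noteq> b"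
      using card_wings[of e] by (auto simp: card_2_iff)
    moreover have F: "a \<in> faces k" "b \<in> faces k"
      using wings_subset_faces[OF e] ab by auto
    ultimately have "p a \<noteq> p b" using inj by (auto simp: inj_on_def)
    with F have "(a, b) \<in> stacking k p \<or> (b, a) \<in> stacking k p"
      by (auto simp: stacking_def)
    with ab show ?thesis by (auto simp: insert_commute)
  qed
  show ?thesis
  proof
    assume L: "noncrossing k (stacking k p)"
    show ?R
    proof (intro ballI impI)
      fix e f assume e: "e \<in> creases k" and f: "f \<in> creases k" and t: "target e = target f"
      obtain a b where ab: "wings e = {a, b}" "(a, b) \<in> stacking k p" using ordered e by blast
      obtain c d where cd: "wings f = {c, d}" "(c, d) \<in> stacking k p" using ordered f by blast
      show "unlinked (span p e) (span p f)"
      proof (cases "e \<noteq> f \<and> wings e \<inter> wings f = {}")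
        case True
        then have "\<not> ((a, c) \<in> stacking k p \<and> (c, b) \<in> stacking k p \<and> (b, d) \<in> stacking k p)"
          "\<not> ((c, a) \<in> stacking k p \<and> (a, d) \<in> stacking k p \<and> (d, b) \<in> stacking k p)"
          using L e f t ab cd unfolding noncrossing_def by blast+
        then show ?thesis using ab cd by (auto simp: span unlinked_def nc_def stacking_def)
      next
        case False
        then have "{a, b} \<inter> {c, d} \<noteq> {}" using ab cd by auto
        then show ?thesis using span[OF ab] span[OF cd] by (auto simp: unlinked_def nc_def)
      qed
    qed
  next
    assume R: ?R
    show "noncrossing k (stacking k p)"
      unfolding noncrossing_def
    proof (intro ballI impI allI)
      fix e f a b c d
      assume ef: "e \<in> creases k" "f \<in> creases k" "e \<noteq> f \<and> target e = target f \<and> wings e \<inter> wings f = {}"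
        and w: "wings e = {a, b} \<and> wings f = {c, d} \<and> (a, b) \<in> stacking k p \<and> (c, d) \<in> stacking k p"
      have "unlinked (span p e) (span p f)" using R ef by blast
      moreover have "span p e = (p a, p b)" "span p f = (p c, p d)" using span w by blast+
      ultimately show "\<not> ((a, c) \<in> stacking k p \<and> (c, b) \<in> stacking k p \<and> (b, d) \<in> stacking k p) \<and>
          \<not> ((c, a) \<in> stacking k p \<and> (a, d) \<in> stacking k p \<and> (d, b) \<in> stacking k p)"
        by (auto simp: unlinked_def nc_def stacking_def)
    qed
  qed
qed

lemma unlinked_ncu: "unlinked (min a b, max a b) (min c d, max c d) \<longleftrightarrow> ncu a b c d"
  by (simp add: unlinked_def ncu_def)

lemma noncrossing_stacking:
  assumes inj: "inj_on (heights x y z w) (faces k)"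
  shows "noncrossing k (stacking k (heights x y z w)) \<longleftrightarrow> laminar k x y z w"
proof -
  define s where "s = span (heights x y z w)"
  have s: "s (Hor (Suc (2*i))) = (min (x i) (z i), max (x i) (z i))"
    "s (Hor (Suc (Suc (2*i)))) = (min (y i) (w i), max (y i) (w i))"
    "s (Up (Suc (2*i))) = (min (x i) (y i), max (x i) (y i))"
    "s (Low (Suc (2*i))) = (min (z i) (w i), max (z i) (w i))"
    "s (Up (Suc (Suc (2*i)))) = (min (x (Suc i)) (y i), max (x (Suc i)) (y i))"
    "s (Low (Suc (Suc (2*i)))) = (min (z (Suc i)) (w i), max (z (Suc i)) (w i))" for i
    by (simp_all add: s_def span_def min.commute max.commute)
  have comm:
    "unlinked (s (Hor (Suc (Suc (2*i))))) (s (Hor (Suc (2*j)))) \<longleftrightarrow>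
     unlinked (s (Hor (Suc (2*j)))) (s (Hor (Suc (Suc (2*i)))))"
    "unlinked (s (Low i)) (s (Up j)) \<longleftrightarrow> unlinked (s (Up j)) (s (Low i))" for i j
    using unlinked_commute by blast+
  show ?thesis
    unfolding noncrossing_spans[OF inj] ball_creases laminar_def unlinked_ncu[symmetric] s[symmetric]
    unfolding s_def[symmetric]
    by (simp del: mult_Suc_right add: comm) blast
qed

text \<open>Each vertex meets horizontal creases of both column parities, so its four signs multiply
  to \<open>delta0\<close> or to \<open>delta1\<close>, depending on the parity of the column; four
  signs have product -1 iff an odd number of them is +1. For \<open>k \<ge> 2\<close> vertices of
  both kinds occur.\<close>

lemma locally_flat_foldable_iff:
  assumes "k \<ge> 2"
  shows "locally_flat_foldable P k \<longleftrightarrow> delta0 P = -1 \<and> delta1 P = -1"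
proof (cases P)
  case (Word h0 h1 u0 u1 l0 l1)
  have filter_insert: "{e \<in> insert a A. Q e} = (if Q a then insert a {e \<in> A. Q e} else {e \<in> A. Q e})"
    for a :: crease and A Q by auto
  have count: "card {e \<in> {Hor c, Hor (c+1), Up c, Low c}. Q e} =
      of_bool (Q (Hor c)) + of_bool (Q (Hor (c+1))) + of_bool (Q (Up c)) + of_bool (Q (Low c))" for Q c
    unfolding filter_insert by simp
  have 1: "odd (card {e \<in> {Hor c, Hor (c+1), Up c, Low c}. crease_label P e = Mountain}) \<longleftrightarrow>
      delta0 P = -1" if "c = Suc (2*i)" for c i
    unfolding count that Word
    by (cases h0; cases h1; cases u0; cases l0) simp_all
  have 2: "odd (card {e \<in> {Hor c, Hor (c+1), Up c, Low c}. crease_label P e = Mountain}) \<longleftrightarrow>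
      delta1 P = -1" if "c = Suc (Suc (2*i))" for c i
    unfolding count that Word
    by (cases h0; cases h1; cases u1; cases l1) simp_all
  have "0 < k" "Suc 0 < k" using assms by auto
  then show ?thesis
    unfolding locally_flat_foldable_def ball_edges using 1 2 by blast
qed

lemma stacking_mem_foldings:
  assumes "k \<ge> 2" "delta0 P = -1" "delta1 P = -1" "inj_on (heights x y z w) (faces k)"
  shows "stacking k (heights x y z w) \<in> foldings P k \<longleftrightarrow> directed P k x y z w \<and> laminar k x y z w"
proof -
  have "stacking k p \<subseteq> faces k \<times> faces k" for p by (auto simp: stacking_def)
  then show ?thesis
    using assms strict_linear_order_stacking[OF assms(4)]
    by (simp add: foldings_def locally_flat_foldable_iff order_valid_def precedence_stacking
        noncrossing_stacking)
qed

lemma foldings_heights: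
  assumes "k \<ge> 2" "R \<in> foldings P k"
  obtains x y z w where "inj_on (heights x y z w) (faces k)" "R = stacking k (heights x y z w)"
    "directed P k x y z w" "laminar k x y z w"
proof -
  have R: "delta0 P = -1" "delta1 P = -1" "order_valid P k R"
    using assms by (auto simp: foldings_def locally_flat_foldable_iff split: if_splits)
  obtain x y z w where h: "inj_on (heights x y z w) (faces k)" "R = stacking k (heights x y z w)"
    using R(3) stacking_heights unfolding order_valid_def by metis
  with R assms show thesis using stacking_mem_foldings that by blast
qed

section \<open>Symmetries of the assignments\<close>

text \<open>Exchanging the rows or mirroring the columns turns light-up faces into dark-up ones,
  which reversing the order compensates; reversing the order alone replaces every label by its
  opposite. Thus all three symmetries contain a reversal.\<close>

definition reversed_image :: "(face \<Rightarrow> face) \<Rightarrow> nat \<Rightarrow> (face \<times> face) set \<Rightarrow> (face \<times> face) set" where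
  "reversed_image f k R = {(u, v). u \<in> faces k \<and> v \<in> faces k \<and> (f v, f u) \<in> R}"

text \<open>Every symmetry used on words is an involution, so an inequality applied in both
  directions yields equality of the counts.\<close>

lemma folding_count_mono:
  assumes k: "k \<ge> 2" and delta: "delta0 Q = delta0 P" "delta1 Q = delta1 P"
    and f: "\<And>u. u \<in> faces k \<Longrightarrow> f u \<in> faces k" "\<And>u. u \<in> faces k \<Longrightarrow> f (f u) = u"
    and step: "\<And>x y z w. directed P k x y z w \<Longrightarrow> laminar k x y z w \<Longrightarrow>
      \<exists>x' y' z' w'. (\<forall>u\<in>faces k. heights x' y' z' w' u = - heights x y z w (f u)) \<and>
        directed Q k x' y' z' w' \<and> laminar k x' y' z' w'"
  shows "folding_count P k \<le> folding_count Q k"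
  unfolding folding_count_def
proof (rule card_inj_on_le[of "reversed_image f k"])
  show "inj_on (reversed_image f k) (foldings P k)"
  proof (rule inj_on_inverseI)
    fix R assume "R \<in> foldings P k"
    then have "R \<subseteq> faces k \<times> faces k"
      by (auto simp: foldings_def order_valid_def split: if_splits)
    then show "reversed_image f k (reversed_image f k R) = R"
      using f by (auto simp: reversed_image_def)
  qed
  show "reversed_image f k ` foldings P k \<subseteq> foldings Q k"
  proof safe
    fix R assume R: "R \<in> foldings P k"
    then have d: "delta0 P = -1" "delta1 P = -1"
      using k by (auto simp: foldings_def locally_flat_foldable_iff split: if_splits)
    obtain x y z w where h: "inj_on (heights x y z w) (faces k)" "R = stacking k (heights x y z w)"
      "directed P k x y z w" "laminar k x y z w"
      using foldings_heights[OF k R] by blast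
    obtain x' y' z' w' where h': "\<forall>u\<in>faces k. heights x' y' z' w' u = - heights x y z w (f u)"
        "directed Q k x' y' z' w'" "laminar k x' y' z' w'"
      using step h(3,4) by blast
    have "inj_on f (faces k)" using f by (metis inj_onI)
    then have inj: "inj_on (heights x' y' z' w') (faces k)"
      using h(1) h'(1) f by (auto simp: inj_on_def)
    have "reversed_image f k R = stacking k (heights x' y' z' w')"
      unfolding h(2) using f h'(1) by (auto simp: reversed_image_def stacking_def)
    with stacking_mem_foldings[OF k _ _ inj] h' d delta
    show "reversed_image f k R \<in> foldings Q k" by simp
  qed
qed (rule finite_foldings)

lemma ncu_commute: "ncu a b c d = ncu b a c d" "ncu a b c d = ncu a b d c" "ncu a b c d = ncu c d a b"
  by (auto simp: ncu_def nc_def min.commute max.commute)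

lemma ncu_uminus: "ncu (-a) (-b) (-c) (-d) = ncu a b c d"
  by (auto simp: ncu_def nc_def min_def max_def)

fun opposite :: "mv \<Rightarrow> mv" where
  "opposite Mountain = Valley"
| "opposite Valley = Mountain"

lemma precedes_uminus: "precedes m (-a) (-b) = precedes m b a"
  by (cases m) auto

lemma precedes_opposite: "precedes (opposite m) a b = precedes m b a"
  by (cases m) auto

lemma folding_count_swap_rows_le:
  assumes "k \<ge> 2"
  shows "folding_count (Word h0 h1 u0 u1 l0 l1) k \<le> folding_count (Word h0 h1 l0 l1 u0 u1) k"
proof (rule folding_count_mono[where f = "case_face Lower Upper", OF assms])
  fix x y z w assume a: "directed (Word h0 h1 u0 u1 l0 l1) k x y z w" "laminar k x y z w"
  have comm: "ncu (z i) (x i) c d = ncu (x i) (z i) c d" "ncu a b (z i) (x i) = ncu a b (x i) (z i)"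
    "ncu (w i) (y i) c d = ncu (y i) (w i) c d" "ncu a b (w i) (y i) = ncu a b (y i) (w i)"
    "ncu (z i) (w i') (x j) (y j') = ncu (x j) (y j') (z i) (w i')" for a b c d i j i' j'
    by (simp_all only: ncu_commute)
  show "\<exists>x' y' z' w'. (\<forall>u\<in>faces k. heights x' y' z' w' u = - heights x y z w (case_face Lower Upper u)) \<and>
        directed (Word h0 h1 l0 l1 u0 u1) k x' y' z' w' \<and> laminar k x' y' z' w'"
    apply (rule exI[of _ "\<lambda>i. - z i"], rule exI[of _ "\<lambda>i. - w i"])
    apply (rule exI[of _ "\<lambda>i. - x i"], rule exI[of _ "\<lambda>i. - y i"])
    using a by (auto simp: ball_faces laminar_def ncu_uminus precedes_uminus comm)
qed (auto simp: faces_def image_iff)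

lemma folding_count_opposite_le:
  assumes "k \<ge> 2"
  shows "folding_count (Word h0 h1 u0 u1 l0 l1) k \<le>
    folding_count (Word (opposite h0) (opposite h1) (opposite u0) (opposite u1) (opposite l0) (opposite l1)) k"
proof (rule folding_count_mono[where f = id, OF assms])
  fix x y z w assume a: "directed (Word h0 h1 u0 u1 l0 l1) k x y z w" "laminar k x y z w"
  show "\<exists>x' y' z' w'. (\<forall>u\<in>faces k. heights x' y' z' w' u = - heights x y z w (id u)) \<and>
        directed (Word (opposite h0) (opposite h1) (opposite u0) (opposite u1) (opposite l0) (opposite l1)) k
           x' y' z' w' \<and> laminar k x' y' z' w'"
    apply (rule exI[of _ "\<lambda>i. - x i"], rule exI[of _ "\<lambda>i. - y i"])
    apply (rule exI[of _ "\<lambda>i. - z i"], rule exI[of _ "\<lambda>i. - w i"])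
    using a by (auto simp: ball_faces laminar_def ncu_uminus precedes_uminus precedes_opposite)
qed (cases h0; cases h1; cases u0; cases u1; cases l0; cases l1; simp)+

fun mirror :: "nat \<Rightarrow> face \<Rightarrow> face" where
  "mirror k (Upper c) = Upper (2*k + 1 - c)"
| "mirror k (Lower c) = Lower (2*k + 1 - c)"

lemma folding_count_swap_columns_le:
  assumes "k \<ge> 2"
  shows "folding_count (Word h0 h1 u0 u1 l0 l1) k \<le> folding_count (Word h1 h0 u0 u1 l0 l1) k"
proof (rule folding_count_mono[where f = "mirror k", OF assms])
  fix x y z w assume a: "directed (Word h0 h1 u0 u1 l0 l1) k x y z w" "laminar k x y z w"
  \<comment> \<open>Column \<open>2*i + 1\<close> changes places with column
    \<open>2*(k - 1 - i) + 2\<close>: the pairs of columns are reversed by \<open>r\<close>, and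
    inside a pair the odd and the even column are exchanged.\<close>
  define r where "r = (\<lambda>i. k - Suc i)"
  have r: "i < k \<Longrightarrow> r i < k" "Suc i < k \<Longrightarrow> r i = Suc (r (Suc i))" "Suc i < k \<Longrightarrow> Suc (r (Suc i)) < k" for i by (auto simp: r_def)
  have m: "mirror k (Upper (Suc (2*i))) = Upper (Suc (Suc (2 * r i)))"
    "mirror k (Upper (Suc (Suc (2*i)))) = Upper (Suc (2 * r i))"
    "mirror k (Lower (Suc (2*i))) = Lower (Suc (Suc (2 * r i)))"
    "mirror k (Lower (Suc (Suc (2*i)))) = Lower (Suc (2 * r i))" if "i < k" for i
    using that by (auto simp: r_def)
  have comm: "ncu (y i) (x i') c d = ncu (x i') (y i) c d" "ncu a b (y i) (x i') = ncu a b (x i') (y i)"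
    "ncu (w i) (z i') c d = ncu (z i') (w i) c d" "ncu a b (w i) (z i') = ncu a b (z i') (w i)"
    "ncu (y i) (w i) (x j) (z j) = ncu (x j) (z j) (y i) (w i)" for a b c d i j i'
    by (simp_all only: ncu_commute)
  show "\<exists>x' y' z' w'. (\<forall>u\<in>faces k. heights x' y' z' w' u = - heights x y z w (mirror k u)) \<and>
        directed (Word h1 h0 u0 u1 l0 l1) k x' y' z' w' \<and> laminar k x' y' z' w'"
    apply (rule exI[of _ "\<lambda>i. - y (r i)"], rule exI[of _ "\<lambda>i. - x (r i)"])
    apply (rule exI[of _ "\<lambda>i. - w (r i)"], rule exI[of _ "\<lambda>i. - z (r i)"])
    using a r by (auto simp: ball_faces m laminar_def ncu_uminus precedes_uminus comm simp del: mirror.simps)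
qed (auto simp: faces_def image_iff)

lemma folding_count_swap_rows:
  "k \<ge> 2 \<Longrightarrow> folding_count (Word h0 h1 u0 u1 l0 l1) k = folding_count (Word h0 h1 l0 l1 u0 u1) k"
  by (intro antisym folding_count_swap_rows_le)

lemma folding_count_swap_columns:
  "k \<ge> 2 \<Longrightarrow> folding_count (Word h0 h1 u0 u1 l0 l1) k = folding_count (Word h1 h0 u0 u1 l0 l1) k"
  by (intro antisym folding_count_swap_columns_le)

lemma opposite_opposite [simp]: "opposite (opposite m) = m"
  by (cases m) auto

lemma folding_count_opposite:
  assumes "k \<ge> 2"
  shows "folding_count (Word h0 h1 u0 u1 l0 l1) k =
    folding_count (Word (opposite h0) (opposite h1) (opposite u0) (opposite u1) (opposite l0) (opposite l1)) k"
  using folding_count_opposite_le[OF assms, of h0 h1 u0 u1 l0 l1]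
    folding_count_opposite_le[OF assms, of "opposite h0" "opposite h1" "opposite u0" "opposite u1"
      "opposite l0" "opposite l1"]
  by simp

section \<open>Codes of pleated rows\<close>

text \<open>In \<open>(m, b)\<close> the index \<open>m\<close> is the apex, and \<open>b\<close> says that the left block precedes the right one. The
  summand \<open>k + 1\<close> exceeds the spread of a block, so its multiples separate the blocks.\<close>

fun code_x :: "nat \<Rightarrow> nat \<times> bool \<Rightarrow> nat \<Rightarrow> int" where
  "code_x k (m, b) i =
     (if i < m then - int i - 1 else if i = m then - 5 * (int k + 1)
      else (if b then 3 else -3) * (int k + 1) + int i - (int k + 1))"

text \<open>Each block is a nest around its centre, 0 on the left and plus or minus
  \<open>3 * (k + 1)\<close> on the right, with the columns lying deeper the farther they are from
  the apex. The apex at \<open>-5 * (k + 1)\<close> precedes both blocks. The even column next to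
  the apex, with height \<open>y m\<close>, belongs to the right block.\<close>

fun code_y :: "nat \<Rightarrow> nat \<times> bool \<Rightarrow> nat \<Rightarrow> int" where
  "code_y k (m, b) i =
     (if i < m then int i + 1 else (if b then 3 else -3) * (int k + 1) + (int k + 1) - int i)"

text \<open>For \<open>m = 0\<close> the left block is empty and the bit carries no information.\<close>

definition codes :: "nat \<Rightarrow> (nat \<times> bool) set" where
  "codes k = insert (0, True) ({1..<k} \<times> UNIV)"

text \<open>Comparisons of \<open>y j\<close> with \<open>x i\<close> are left out: where these
  heights are distinct, they are the negations of the listed ones.\<close>

definition same_row :: "nat \<Rightarrow> (nat \<Rightarrow> int) \<Rightarrow> (nat \<Rightarrow> int) \<Rightarrow> (nat \<Rightarrow> int) \<Rightarrow> (nat \<Rightarrow> int) \<Rightarrow> bool" where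
  "same_row k x y x' y' \<longleftrightarrow> (\<forall>i<k. \<forall>j<k.
     (x i < x j \<longleftrightarrow> x' i < x' j) \<and> (y i < y j \<longleftrightarrow> y' i < y' j) \<and> (x i < y j \<longleftrightarrow> x' i < y' j))"

lemma strict_mono_upto:
  fixes f :: "nat \<Rightarrow> int"
  assumes "\<And>i. a \<le> i \<Longrightarrow> i < b \<Longrightarrow> f i < f (Suc i)" "a \<le> i" "i < j" "j \<le> b"
  shows "f i < f j"
  using assms(3,4)
proof (induction j)
  case (Suc j)
  then show ?case using assms(1)[of j] assms(2) by (cases "i = j") auto
qed simp

text \<open>This isolates what East edges (\<open>nc_odd\<close>) and West edges
  (\<open>nc_even\<close>) say about a single row, so that it applies to upper rows, to lower rows,
  and to lower rows turned upside down by negating heights.\<close>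

locale pleated_row =
  fixes k :: nat and x y :: "nat \<Rightarrow> int"
  assumes x_inj: "\<lbrakk>i < k; j < k; x i = x j\<rbrakk> \<Longrightarrow> i = j"
    and y_inj: "\<lbrakk>i < k; j < k; y i = y j\<rbrakk> \<Longrightarrow> i = j"
    and x_neq_y: "\<lbrakk>i < k; j < k\<rbrakk> \<Longrightarrow> x i \<noteq> y j"
    and x_less_y: "i < k \<Longrightarrow> x i < y i"
    and x_Suc_less_y: "Suc i < k \<Longrightarrow> x (Suc i) < y i"
    and nc_odd: "\<lbrakk>i < k; j < k\<rbrakk> \<Longrightarrow> nc (x i) (y i) (x j) (y j)"
    and nc_even: "\<lbrakk>Suc i < k; Suc j < k\<rbrakk> \<Longrightarrow> nc (x (Suc i)) (y i) (x (Suc j)) (y j)"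
begin

text \<open>Induction from the apex to the left. If one end of an edge lies inside the next edge of
  the same class towards the apex, so does the other end. Applied to the West edges this gives the
  order of the \<open>y\<close>, and then to the East edges the order of the \<open>x\<close>.
  Nothing is claimed about \<open>y (m - 1)\<close> and \<open>y m\<close>: their order is the free
  bit.\<close>

lemma left_step:
  assumes m: "m < k" "\<And>i. i < k \<Longrightarrow> x m \<le> x i" and "i < m"
  shows "x (Suc i) < x i \<and> (Suc i < m \<longrightarrow> y i < y (Suc i))"
  using \<open>i < m\<close>
proof (induction "m - i" arbitrary: i rule: less_induct)
  case less
  show ?case
  proof (cases "Suc i = m")
    case True
    then have "x m \<noteq> x i" using x_inj[of m i] m(1) by auto
    then show ?thesis using m(2)[of i] m(1) True by auto
  next
    case False
    with less.prems have i: "Suc i < m" by simp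
    with less.hyps[of "Suc i"] have 1: "x (Suc (Suc i)) < x (Suc i)" by simp
    have k: "i < k" "Suc i < k" "Suc (Suc i) < k" using i m(1) by auto
    have neq: "x i \<noteq> x (Suc i)" "y i \<noteq> y (Suc i)" using x_inj[of i "Suc i"] y_inj[of i "Suc i"] k by auto
    have 2: "y i < y (Suc i)"
      using nc_even[OF k(2,3)] 1 x_less_y[OF k(2)] x_Suc_less_y[OF k(2)] neq by (auto simp: nc_def)
    then have "x (Suc i) < x i"
      using nc_odd[OF k(1,2)] x_less_y[OF k(1)] x_Suc_less_y[OF k(2)] neq by (auto simp: nc_def)
    with 2 show ?thesis by simp
  qed
qed

text \<open>The same alternation of classes to the right. It starts with the East edge of the apex,
  which contains \<open>x (Suc m)\<close>, so here \<open>y m\<close> is included.\<close>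

lemma right_step:
  assumes m: "m < k" "\<And>i. i < k \<Longrightarrow> x m \<le> x i" and "m \<le> i" "Suc i < k"
  shows "x i < x (Suc i) \<and> y (Suc i) < y i"
  using \<open>m \<le> i\<close> \<open>Suc i < k\<close>
proof (induction i rule: dec_induct)
  case base
  then have "x m \<noteq> x (Suc m)" "y m \<noteq> y (Suc m)"
    using x_inj[of m "Suc m"] y_inj[of m "Suc m"] by auto
  then show ?case
    using m(2)[OF base] x_Suc_less_y[OF base] nc_odd[OF m(1) base] by (auto simp: nc_def)
next
  case (step i)
  then have 1: "x i < x (Suc i)" "y (Suc i) < y i" and k: "Suc i < k" "Suc (Suc i) < k" by auto
  have neq: "x (Suc i) \<noteq> x (Suc (Suc i))" "y (Suc i) \<noteq> y (Suc (Suc i))"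
    using x_inj[of "Suc i" "Suc (Suc i)"] y_inj[of "Suc i" "Suc (Suc i)"] k by auto
  have 2: "x (Suc i) < x (Suc (Suc i))"
    using nc_even[OF k] 1 x_less_y[OF k(1)] x_Suc_less_y[OF k(2)] neq by (auto simp: nc_def)
  then have "y (Suc (Suc i)) < y (Suc i)"
    using nc_odd[OF k] x_Suc_less_y[OF k(2)] neq by (auto simp: nc_def)
  with 2 show ?case by simp
qed

text \<open>The two step lemmas order each block; what remains is the position of the blocks
  relative to each other, which the order of \<open>y (m - 1)\<close> and \<open>y m\<close>
  decides.\<close>

lemma ex_code:
  assumes "k > 0"
  shows "\<exists>c\<in>codes k. same_row k x y (code_x k c) (code_y k c)"
proof -
  have "Min (x ` {..<k}) \<in> x ` {..<k}" using assms by (intro Min_in) auto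
  then obtain m where m: "m < k" "x m = Min (x ` {..<k})" by auto
  have "x m \<le> x i" if "i < k" for i unfolding m(2) using that by (intro Min_le) auto
  note m = m(1) this
  note left = left_step[OF m] and right = right_step[OF m]
  have L1: "x j < x i" if "i < j" "j \<le> m" for i j
    using strict_mono_upto[of 0 m "\<lambda>i. - x i" i j] left that by auto
  have L2: "y i < y j" if "i < j" "j < m" for i j
    using strict_mono_upto[of 0 "m - 1" y i j] left that by auto
  have R1: "x i < x j" if "m \<le> i" "i < j" "j < k" for i j
    using strict_mono_upto[of m "k - 1" x i j] right that by auto
  have R2: "y j < y i" if "m \<le> i" "i < j" "j < k" for i j
    using strict_mono_upto[of m "k - 1" "\<lambda>i. - y i" i j] right that by auto
  have L3: "x i < y j" if "i < m" "j < m" for i j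
    using L1[of j i] L2[of i j] x_less_y[of i] x_less_y[of j] that m(1)
    by (cases i j rule: linorder_cases) auto
  have R3: "x i < y j" if "m \<le> i" "m \<le> j" "i < k" "j < k" for i j
    using R1[of i j] R2[of j i] x_less_y[of i] x_less_y[of j] that
    by (cases i j rule: linorder_cases) auto
  have M1: "x m < x i" if "i < k" "i \<noteq> m" for i
    using m x_inj[of m i] that by force
  have M2: "x m < y i" if "i < k" for i
    using m(2)[of i] x_less_y[of i] that by auto
  \<comment> \<open>The value for \<open>m = 0\<close> agrees with the normalised code
    \<open>(0, True)\<close>.\<close>
  define b where "b = (m = 0 \<or> y (m - 1) < y m)"
  \<comment> \<open>The West edge from \<open>x m\<close> to \<open>y p\<close> ends before
    \<open>y m\<close>. If \<open>x (Suc m)\<close> lay inside it, the West edge from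
    \<open>x (Suc m)\<close> to \<open>y m\<close> would cross it, so the left block ends before the
    right one begins.\<close>
  have LR: "y i < y j" "m < j \<Longrightarrow> y i < x j" if b "i < m" "m \<le> j" "j < k" for i j
  proof -
    from that obtain p where p: "m = Suc p" by (cases m) auto
    with that b_def have pm: "y p < y m" by auto
    have ip: "y i \<le> y p" using L2[of i p] that p by (cases "i = p") auto
    have x: "y p < x (Suc m)" if "Suc m < k"
      using nc_even[of m p] that M1[of "Suc m"] M2[of p] pm p x_neq_y[of "Suc m" p] m(1)
      unfolding nc_def by auto
    show *: "y i < x j" if "m < j"
      using x R1[of "Suc m" j] that \<open>j < k\<close> ip by (cases "Suc m = j") auto
    show "y i < y j" 
      using * x_less_y[of j] pm ip that by (cases "m = j") auto
  qed
  \<comment> \<open>Now the East edge from \<open>x m\<close> to \<open>y m\<close> ends before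
    \<open>y p\<close>, and the East edge from \<open>x p\<close> to \<open>y p\<close> would cross
    it if \<open>x p\<close> lay inside.\<close>
  have RL: "y j < x i" if "\<not> b" "i < m" "m \<le> j" "j < k" for i j
  proof -
    from that obtain p where p: "m = Suc p" by (cases m) auto
    with that b_def m(1) y_inj[of p m] have pm: "y m < y p" by fastforce
    have "y m < x p"
      using nc_odd[of p m] M1[of p] m(1) p M2[of m] pm x_neq_y[of p m] unfolding nc_def by auto
    moreover have "x p \<le> x i" using L1[of i p] that p by (cases "i = p") auto
    moreover have "y j \<le> y m" using R2[of m j] that by (cases "m = j") auto
    ultimately show ?thesis by simp
  qed
  have "same_row k x y (code_x k (m, b)) (code_y k (m, b))"
    unfolding same_row_def
  proof (intro allI impI)
    fix i j assume ij: "i < k" "j < k"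
    note facts = ij m(1) L1[of i j] L1[of j i] L2[of i j] L2[of j i] L3[of i j]
      R1[of i j] R1[of j i] R2[of i j] R2[of j i] R3[of i j] M1[of i] M1[of j] M2[of j] 
      LR[of i j] LR[of j i] RL[of i j] RL[of j i] x_less_y[of i] x_less_y[of j]
    show "(x i < x j \<longleftrightarrow> code_x k (m, b) i < code_x k (m, b) j) \<and>
      (y i < y j \<longleftrightarrow> code_y k (m, b) i < code_y k (m, b) j) \<and>
      (x i < y j \<longleftrightarrow> code_x k (m, b) i < code_y k (m, b) j)"
      by (cases i j rule: linorder_cases; cases i m rule: linorder_cases; cases j m rule: linorder_cases;
          cases b; insert facts; simp)
  qed
  moreover have "(m, b) \<in> codes k" using m(1) by (auto simp: codes_def b_def)
  ultimately show ?thesis by blast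
qed

end

section \<open>Comparing two tuples of heights\<close>

lemma odd_neq_even: "Suc (2*i) \<noteq> 2*j" "2*j \<noteq> Suc (2*i)" for i j :: nat
  by presburger+

lemma inj_on_heights_iff:
  "inj_on (heights x y z w) (faces k) \<longleftrightarrow> (\<forall>i<k. \<forall>j<k.
     (x i = x j \<longrightarrow> i = j) \<and> (y i = y j \<longrightarrow> i = j) \<and> (z i = z j \<longrightarrow> i = j) \<and> (w i = w j \<longrightarrow> i = j) \<and>
     x i \<noteq> y j \<and> x i \<noteq> z j \<and> x i \<noteq> w j \<and> y i \<noteq> z j \<and> y i \<noteq> w j \<and> z i \<noteq> w j)"
    (is "?L \<longleftrightarrow> ?R")
proof
  assume inj: ?L
  show ?R
  proof (intro allI impI)
    fix i j assume "i < k" "j < k"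
    then show "(x i = x j \<longrightarrow> i = j) \<and> (y i = y j \<longrightarrow> i = j) \<and> (z i = z j \<longrightarrow> i = j) \<and> (w i = w j \<longrightarrow> i = j) \<and>
        x i \<noteq> y j \<and> x i \<noteq> z j \<and> x i \<noteq> w j \<and> y i \<noteq> z j \<and> y i \<noteq> w j \<and> z i \<noteq> w j"
      using inj_on_eq_iff[OF inj, of "Upper (Suc (2*i))" "Upper (Suc (2*j))"]
        inj_on_eq_iff[OF inj, of "Upper (Suc (Suc (2*i)))" "Upper (Suc (Suc (2*j)))"]
        inj_on_eq_iff[OF inj, of "Lower (Suc (2*i))" "Lower (Suc (2*j))"]
        inj_on_eq_iff[OF inj, of "Lower (Suc (Suc (2*i)))" "Lower (Suc (Suc (2*j)))"]
        inj_on_eq_iff[OF inj, of "Upper (Suc (2*i))" "Upper (Suc (Suc (2*j)))"]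
        inj_on_eq_iff[OF inj, of "Upper (Suc (2*i))" "Lower (Suc (2*j))"]
        inj_on_eq_iff[OF inj, of "Upper (Suc (2*i))" "Lower (Suc (Suc (2*j)))"]
        inj_on_eq_iff[OF inj, of "Upper (Suc (Suc (2*i)))" "Lower (Suc (2*j))"]
        inj_on_eq_iff[OF inj, of "Upper (Suc (Suc (2*i)))" "Lower (Suc (Suc (2*j)))"]
        inj_on_eq_iff[OF inj, of "Lower (Suc (2*i))" "Lower (Suc (Suc (2*j)))"]
      by (simp add: odd_neq_even)
  qed
next
  assume ?R
  then have R: "i < k \<Longrightarrow> j < k \<Longrightarrow> x i = x j \<longleftrightarrow> i = j" "i < k \<Longrightarrow> j < k \<Longrightarrow> y i = y j \<longleftrightarrow> i = j"
    "i < k \<Longrightarrow> j < k \<Longrightarrow> z i = z j \<longleftrightarrow> i = j" "i < k \<Longrightarrow> j < k \<Longrightarrow> w i = w j \<longleftrightarrow> i = j"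
    "i < k \<Longrightarrow> j < k \<Longrightarrow> x i \<noteq> y j" "i < k \<Longrightarrow> j < k \<Longrightarrow> x i \<noteq> z j" "i < k \<Longrightarrow> j < k \<Longrightarrow> x i \<noteq> w j"
    "i < k \<Longrightarrow> j < k \<Longrightarrow> y i \<noteq> z j" "i < k \<Longrightarrow> j < k \<Longrightarrow> y i \<noteq> w j" "i < k \<Longrightarrow> j < k \<Longrightarrow> z i \<noteq> w j" for i j
    by blast+
  have "\<forall>u\<in>faces k. \<forall>v\<in>faces k. heights x y z w u = heights x y z w v \<longrightarrow> u = v"
    unfolding ball_faces by (simp add: R R(5-)[symmetric] odd_neq_even)
  then show ?L by (auto simp: inj_on_def)
qed

lemma stacking_eqI:
  assumes inj: "inj_on (heights x y z w) (faces k)" "inj_on (heights x' y' z' w') (faces k)"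
    and rows: "same_row k x y x' y'" "same_row k z w z' w'"
    and cross: "\<And>i j. i < k \<Longrightarrow> j < k \<Longrightarrow> (x i < z j \<longleftrightarrow> x' i < z' j) \<and> (x i < w j \<longleftrightarrow> x' i < w' j) \<and>
      (y i < z j \<longleftrightarrow> y' i < z' j) \<and> (y i < w j \<longleftrightarrow> y' i < w' j)"
  shows "stacking k (heights x y z w) = stacking k (heights x' y' z' w')"
proof -
  have gt: "b < a \<longleftrightarrow> b' < a'" if "a < b \<longleftrightarrow> a' < b'" "a \<noteq> b" "a' \<noteq> b'" for a b a' b' :: int
    using that by auto
  have less: "x i < x j \<longleftrightarrow> x' i < x' j" "y i < y j \<longleftrightarrow> y' i < y' j" "z i < z j \<longleftrightarrow> z' i < z' j"
    "w i < w j \<longleftrightarrow> w' i < w' j" "x i < y j \<longleftrightarrow> x' i < y' j" "z i < w j \<longleftrightarrow> z' i < w' j"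
    "x i < z j \<longleftrightarrow> x' i < z' j" "x i < w j \<longleftrightarrow> x' i < w' j" "y i < z j \<longleftrightarrow> y' i < z' j"
    "y i < w j \<longleftrightarrow> y' i < w' j" if "i < k" "j < k" for i j
    using rows cross that unfolding same_row_def by blast+
  have neq: "x i \<noteq> y j" "x i \<noteq> z j" "x i \<noteq> w j" "y i \<noteq> z j" "y i \<noteq> w j" "z i \<noteq> w j"
    "x' i \<noteq> y' j" "x' i \<noteq> z' j" "x' i \<noteq> w' j" "y' i \<noteq> z' j" "y' i \<noteq> w' j" "z' i \<noteq> w' j"
    if "i < k" "j < k" for i j
    using inj that unfolding inj_on_heights_iff by blast+
  have greater: "y i < x j \<longleftrightarrow> y' i < x' j" "w i < z j \<longleftrightarrow> w' i < z' j" "z i < x j \<longleftrightarrow> z' i < x' j"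
    "w i < x j \<longleftrightarrow> w' i < x' j" "z i < y j \<longleftrightarrow> z' i < y' j" "w i < y j \<longleftrightarrow> w' i < y' j"
    if "i < k" "j < k" for i j
    by (rule gt; simp add: less neq that)+
  have "\<forall>u\<in>faces k. \<forall>v\<in>faces k.
      heights x y z w u < heights x y z w v \<longleftrightarrow> heights x' y' z' w' u < heights x' y' z' w' v"
    unfolding ball_faces by (simp add: less greater)
  then show ?thesis by (auto simp: stacking_def)
qed

lemma ncu_ordered: "a < b \<Longrightarrow> c < d \<Longrightarrow> ncu a b c d = nc a b c d"
  by (simp add: ncu_def)

lemma nc_commute: "nc a b c d = nc c d a b"
  by (auto simp: nc_def)

lemma nc_uminus: "nc (-a) (-b) (-c) (-d) = nc b a d c"
  by (auto simp: nc_def)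

text \<open>If \<open>a < d\<close>, then \<open>c < a\<close> and \<open>d < b\<close> together
  would be a crossing; if not, the second interval lies entirely before the first up to touching,
  which gives both.\<close>

lemma nc_less_iff: "nc a b c d \<Longrightarrow> a < b \<Longrightarrow> c < d \<Longrightarrow> a < d \<longleftrightarrow> \<not> (c < a \<and> d < b)"
  by (auto simp: nc_def)

lemma same_row_trans:
  "same_row k x y a b \<Longrightarrow> same_row k x' y' a b \<Longrightarrow> same_row k x y x' y'"
  by (simp add: same_row_def)

text \<open>The apex is read off as the first \<open>x\<close>, and the bit for \<open>m > 0\<close>
  as the order of \<open>y (m - 1)\<close> and \<open>y m\<close>.\<close>

lemma same_row_code_inj:
  assumes "c \<in> codes k" "d \<in> codes k" "same_row k x y (code_x k c) (code_y k c)"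
    "same_row k x y (code_x k d) (code_y k d)" "k > 0"
  shows "c = d"
proof -
  obtain m b where c: "c = (m, b)" by fastforce
  obtain n e where d: "d = (n, e)" by fastforce
  have mn: "m < k" "n < k" using assms by (auto simp: codes_def c d)
  have S: "code_x k c i < code_x k c j \<longleftrightarrow> code_x k d i < code_x k d j"
    "code_y k c i < code_y k c j \<longleftrightarrow> code_y k d i < code_y k d j" if "i < k" "j < k" for i j
    using assms(3,4) that unfolding same_row_def by blast+
  have m: "m = n"
    using S(1)[OF mn] S(1)[OF mn(2,1)] mn by (cases m n rule: linorder_cases) (auto simp: c d split: if_splits)
  have "b = e"
  proof (cases "m = 0")
    case True
    then show ?thesis using assms(1,2) m by (auto simp: codes_def c d)
  next
    case False
    then have "m - 1 < k" using mn by simp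
    with False show ?thesis using S(2)[of "m - 1" m] mn m by (cases b; cases e) (auto simp: c d)
  qed
  with m show ?thesis by (simp add: c d)
qed

section \<open>Rows pleated in opposite directions\<close>

locale antiparallel_rows =
  fixes k :: nat and x y z w :: "nat \<Rightarrow> int"
  assumes k: "k \<ge> 2"
    and inj: "inj_on (heights x y z w) (faces k)"
    and directed: "directed (Word Mountain Valley Mountain Mountain Mountain Mountain) k x y z w"
    and laminar: "laminar k x y z w"
begin

lemma less:
  "i < k \<Longrightarrow> x i < z i" "i < k \<Longrightarrow> y i < w i" "i < k \<Longrightarrow> x i < y i" "i < k \<Longrightarrow> w i < z i"
  "Suc i < k \<Longrightarrow> x (Suc i) < y i" "Suc i < k \<Longrightarrow> w i < z (Suc i)"
  using directed by auto

lemma nc_Hor: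
  assumes "i < k" "j < k"
  shows "nc (x i) (z i) (x j) (z j)" "nc (y i) (w i) (y j) (w j)" "nc (x i) (z i) (y j) (w j)"
    "nc (y i) (w i) (x j) (z j)"
proof -
  have "ncu (x i) (z i) (x j) (z j)" "ncu (y i) (w i) (y j) (w j)" "ncu (x i) (z i) (y j) (w j)"
    "ncu (x j) (z j) (y i) (w i)"
    using laminar assms unfolding laminar_def by blast+
  then show "nc (x i) (z i) (x j) (z j)" "nc (y i) (w i) (y j) (w j)" "nc (x i) (z i) (y j) (w j)"
    "nc (y i) (w i) (x j) (z j)"
    using assms by (simp_all add: ncu_ordered less nc_commute[of "y i"])
qed

lemma nc_Up:
  "\<lbrakk>i < k; j < k\<rbrakk> \<Longrightarrow> nc (x i) (y i) (x j) (y j)"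
  "\<lbrakk>Suc i < k; Suc j < k\<rbrakk> \<Longrightarrow> nc (x (Suc i)) (y i) (x (Suc j)) (y j)"
  using laminar less(3,5) unfolding laminar_def by (metis ncu_ordered)+

lemma nc_Low:
  "\<lbrakk>i < k; j < k\<rbrakk> \<Longrightarrow> nc (w i) (z i) (w j) (z j)"
  "\<lbrakk>Suc i < k; Suc j < k\<rbrakk> \<Longrightarrow> nc (w i) (z (Suc i)) (w j) (z (Suc j))"
  using laminar less(4,6) unfolding laminar_def by (metis ncu_ordered ncu_commute(1,2))+

text \<open>Every horizontal crease starts at an upper face and ends at a lower one, so
  \<open>nc_less_iff\<close> covers all comparisons between the rows.\<close>

lemma cross_less_iff:
  assumes "i < k" "j < k"
  shows "x i < z j \<longleftrightarrow> \<not> (x j < x i \<and> z j < z i)" "x i < w j \<longleftrightarrow> \<not> (y j < x i \<and> w j < z i)"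
    "y i < z j \<longleftrightarrow> \<not> (x j < y i \<and> z j < w i)" "y i < w j \<longleftrightarrow> \<not> (y j < y i \<and> w j < w i)"
  by (rule nc_less_iff; simp add: assms nc_Hor less)+

sublocale upper: pleated_row k x y
  using inj by unfold_locales (simp_all add: inj_on_heights_iff less nc_Up)

sublocale lower: pleated_row k "\<lambda>i. - z i" "\<lambda>i. - w i"
  using inj by unfold_locales (simp_all add: inj_on_heights_iff less nc_Low nc_uminus not_sym)

text \<open>The last \<open>z\<close> belongs to the lower apex \<open>n\<close>, so it suffices
  that no \<open>z i\<close> lies after \<open>z m\<close>. Moving outwards from \<open>m\<close>,
  the next odd horizontal crease starts before an adjacent \<open>w i\<close>, which lies before
  \<open>z m\<close> by induction. It thus starts inside the crease at \<open>m\<close> and has to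
  end there.\<close>

lemma same_apex:
  assumes c: "c \<in> codes k" "same_row k x y (code_x k c) (code_y k c)"
    and d: "d \<in> codes k" "same_row k (\<lambda>i. - z i) (\<lambda>i. - w i) (code_x k d) (code_y k d)"
  shows "fst c = fst d"
proof -
  obtain m b where c': "c = (m, b)" by fastforce
  obtain n e where d': "d = (n, e)" by fastforce
  have mn: "m < k" "n < k" using k c d by (auto simp: codes_def c' d')
  have min: "x m \<le> x i" if "i < k" for i
  proof (cases "i = m")
    case False
    then have "code_x k c m < code_x k c i" using that mn by (auto simp: c')
    then show ?thesis using c(2) that mn unfolding same_row_def by force
  qed simp
  have right: "z i \<le> z m" if "m \<le> i" "i < k" for i
    using that
  proof (induction i rule: dec_induct)
    case (step i)
    then have "w i < z m" "x m \<le> x (Suc i)" "x (Suc i) < y i" "y i < w i" "w i < z (Suc i)"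
      using less(2,4,5,6)[of i] min[of "Suc i"] by auto
    then show ?case using nc_Hor(1)[of m "Suc i"] mn step.prems upper.x_inj[of m "Suc i"] by (cases "x m = x (Suc i)") (auto simp: nc_def)
  qed simp
  have left: "z i \<le> z m" if "i \<le> m" for i
    using that
  proof (induction i rule: inc_induct)
    case (step i)
    then have k: "i < k" "Suc i < k" using mn by auto
    then have "w i < z m" "x m \<le> x i" "x i < y i" "y i < w i" "w i < z i"
      using less(2,3,4,6)[of i] min[of "i"] step by auto
    then show ?case using nc_Hor(1)[of m i] mn k upper.x_inj[of m i] by (cases "x m = x i") (auto simp: nc_def)
  qed simp
  have "z n \<le> z m" using left right mn by (cases "n \<le> m") auto
  have "m = n"
  proof (rule ccontr)
    assume "m \<noteq> n"
    then have "code_x k d n < code_x k d m" using mn by (auto simp: d')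
    then have "- z n < - z m" using d(2) mn unfolding same_row_def by force
    with \<open>z n \<le> z m\<close> show False by simp
  qed
  then show ?thesis by (simp add: c' d')
qed

end

section \<open>Counting foldings by their codes\<close>

lemma stacking_eqD:
  assumes "stacking k (heights x y z w) = stacking k (heights x' y' z' w')" "i < k" "j < k"
  shows "x i < x j \<longleftrightarrow> x' i < x' j" "y i < y j \<longleftrightarrow> y' i < y' j" "x i < y j \<longleftrightarrow> x' i < y' j"
    "z i < z j \<longleftrightarrow> z' i < z' j" "w i < w j \<longleftrightarrow> w' i < w' j" "z i < w j \<longleftrightarrow> z' i < w' j"
    "w i < z j \<longleftrightarrow> w' i < z' j"
proof -
  have S: "heights x y z w u < heights x y z w v \<longleftrightarrow> heights x' y' z' w' u < heights x' y' z' w' v"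
    if "u \<in> faces k" "v \<in> faces k" for u v
    using assms(1) that unfolding stacking_def by blast
  show "x i < x j \<longleftrightarrow> x' i < x' j" "y i < y j \<longleftrightarrow> y' i < y' j" "x i < y j \<longleftrightarrow> x' i < y' j"
    "z i < z j \<longleftrightarrow> z' i < z' j" "w i < w j \<longleftrightarrow> w' i < w' j" "z i < w j \<longleftrightarrow> z' i < w' j"
    "w i < z j \<longleftrightarrow> w' i < z' j"
    using S[of "Upper (Suc (2*i))" "Upper (Suc (2*j))"]
      S[of "Upper (Suc (Suc (2*i)))" "Upper (Suc (Suc (2*j)))"]
      S[of "Upper (Suc (2*i))" "Upper (Suc (Suc (2*j)))"]
      S[of "Lower (Suc (2*i))" "Lower (Suc (2*j))"]
      S[of "Lower (Suc (Suc (2*i)))" "Lower (Suc (Suc (2*j)))"]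
      S[of "Lower (Suc (2*i))" "Lower (Suc (Suc (2*j)))"]
      S[of "Lower (Suc (Suc (2*i)))" "Lower (Suc (2*j))"] assms(2,3)
    by simp_all
qed

text \<open>The sign \<open>s\<close> is \<open>-1\<close> if the lower row has to be turned upside down to become a pleated row.\<close>

definition has_code ::
    "nat \<Rightarrow> int \<Rightarrow> (nat \<Rightarrow> int) \<Rightarrow> (nat \<Rightarrow> int) \<Rightarrow> (nat \<Rightarrow> int) \<Rightarrow> (nat \<Rightarrow> int) \<Rightarrow> (nat \<times> bool) \<times> (nat \<times> bool) \<Rightarrow> bool" where
  "has_code k s x y z w cd \<longleftrightarrow>
     same_row k x y (code_x k (fst cd)) (code_y k (fst cd)) \<and>
     same_row k (\<lambda>i. s * z i) (\<lambda>i. s * w i) (code_x k (snd cd)) (code_y k (snd cd))"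

lemma folding_count_eq_card_codes:
  assumes k: "k \<ge> 2" and delta: "delta0 P = -1" "delta1 P = -1" and s: "s = 1 \<or> s = -1"
    and C: "C \<subseteq> codes k \<times> codes k"
    and realised: "\<And>c. c \<in> C \<Longrightarrow> \<exists>x y z w. inj_on (heights x y z w) (faces k) \<and>
      directed P k x y z w \<and> laminar k x y z w \<and> has_code k s x y z w c"
    and coded: "\<And>x y z w. inj_on (heights x y z w) (faces k) \<Longrightarrow> directed P k x y z w \<Longrightarrow>
      laminar k x y z w \<Longrightarrow> \<exists>c\<in>C. has_code k s x y z w c"
    and determined: "\<And>x y z w x' y' z' w' c. c \<in> C \<Longrightarrow>
      inj_on (heights x y z w) (faces k) \<Longrightarrow> directed P k x y z w \<Longrightarrow>
      laminar k x y z w \<Longrightarrow> has_code k s x y z w c \<Longrightarrow>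
      inj_on (heights x' y' z' w') (faces k) \<Longrightarrow> directed P k x' y' z' w' \<Longrightarrow>
      laminar k x' y' z' w' \<Longrightarrow> has_code k s x' y' z' w' c \<Longrightarrow>
      stacking k (heights x y z w) = stacking k (heights x' y' z' w')"
  shows "folding_count P k = card C"
proof -
  \<comment> \<open>An order has many height tuples, so codes are attached to orders by a relation;
    \<open>unique\<close> shows that the choice of the tuple does not matter.\<close>
  define rel where "rel = (\<lambda>R c. \<exists>x y z w. R = stacking k (heights x y z w) \<and>
    inj_on (heights x y z w) (faces k) \<and> directed P k x y z w \<and> laminar k x y z w \<and> has_code k s x y z w c)"
  have total: "\<exists>c\<in>C. rel R c" if "R \<in> foldings P k" for R
    using foldings_heights[OF k that] coded unfolding rel_def by metis
  have onto: "\<exists>R\<in>foldings P k. rel R c" if "c \<in> C" for c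
    using realised[OF that] stacking_mem_foldings[OF k delta] unfolding rel_def by blast
  have inj: "R = R'" if "rel R c" "rel R' c" "c \<in> C" for R R' c
    using that determined[OF that(3)] unfolding rel_def by metis
  have unique: "c = d" if rel: "rel R c" "rel R d" and cd: "c \<in> C" "d \<in> C" for R c d
  proof -
    obtain x y z w where c: "R = stacking k (heights x y z w)" "has_code k s x y z w c"
      using rel(1) unfolding rel_def by blast
    obtain x' y' z' w' where d: "R = stacking k (heights x' y' z' w')"
        "inj_on (heights x' y' z' w') (faces k)" "has_code k s x' y' z' w' d"
      using rel(2) unfolding rel_def by blast
    note eq = stacking_eqD[OF d(1)[unfolded c(1)]]
    \<comment> \<open>Both tuples describe the same order, so a code of one is a code of the other.
      For \<open>s = -1\<close>, comparing \<open>s * z i\<close> with \<open>s * w j\<close> means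
      comparing \<open>w j\<close> with \<open>z i\<close>.\<close>
    have "has_code k s x y z w d"
      using d(3) s by (elim disjE) (simp_all add: has_code_def same_row_def eq)
    moreover have "fst c \<in> codes k" "fst d \<in> codes k" "snd c \<in> codes k" "snd d \<in> codes k"
      using C cd by auto
    ultimately have "fst c = fst d" "snd c = snd d"
      using c(2) k unfolding has_code_def
      by (metis same_row_code_inj zero_less_numeral less_le_trans)+
    then show ?thesis by (simp add: prod_eq_iff)
  qed
  have "bij_betw (\<lambda>R. THE c. c \<in> C \<and> rel R c) (foldings P k) C"
  proof -
    have the: "(THE c. c \<in> C \<and> rel R c) = c" if "rel R c" "c \<in> C" for R c
      using that unique by blast
    show ?thesis
    proof (rule bij_betwI')
      fix R R' assume "R \<in> foldings P k" "R' \<in> foldings P k"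
      then obtain c c' where c: "c \<in> C" "rel R c" "c' \<in> C" "rel R' c'" using total by blast
      have "c = c' \<longleftrightarrow> R = R'" using c inj unique by blast
      with c show "((THE c. c \<in> C \<and> rel R c) = (THE c. c \<in> C \<and> rel R' c)) = (R = R')"
        by (simp add: the)
    next
      fix R assume "R \<in> foldings P k"
      then show "(THE c. c \<in> C \<and> rel R c) \<in> C" using total the by metis
    next
      fix c assume "c \<in> C"
      then show "\<exists>R\<in>foldings P k. c = (THE c. c \<in> C \<and> rel R c)" using onto the by metis
    qed
  qed
  then show ?thesis unfolding folding_count_def by (rule bij_betw_same_card)
qed

lemma antiparallel_determined:
  assumes "antiparallel_rows k x y z w" "antiparallel_rows k x' y' z' w'"
    "has_code k (-1) x y z w c" "has_code k (-1) x' y' z' w' c"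
  shows "stacking k (heights x y z w) = stacking k (heights x' y' z' w')"
proof -
  interpret a: antiparallel_rows k x y z w by fact
  interpret b: antiparallel_rows k x' y' z' w' by fact
  have rows: "same_row k x y x' y'" and neg: "same_row k (\<lambda>i. - z i) (\<lambda>i. - w i) (\<lambda>i. - z' i) (\<lambda>i. - w' i)"
    using assms(3,4) unfolding has_code_def by (auto intro: same_row_trans)
  have zw: "z i < z j \<longleftrightarrow> z' i < z' j" "w i < w j \<longleftrightarrow> w' i < w' j" "w j < z i \<longleftrightarrow> w' j < z' i"
    if "i < k" "j < k" for i j
    using neg that unfolding same_row_def by auto
  have yx: "y j < x i \<longleftrightarrow> y' j < x' i" if "i < k" "j < k" for i j
    using rows a.upper.x_neq_y[of i j] b.upper.x_neq_y[of i j] that unfolding same_row_def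
    by (meson linorder_neqE order_less_asym)
  have zw': "z i < w j \<longleftrightarrow> z' i < w' j" if "i < k" "j < k" for i j
    using zw(3)[OF that] a.lower.x_neq_y[of i j] b.lower.x_neq_y[of i j] that by auto
  have xy: "x i < x j \<longleftrightarrow> x' i < x' j" "y i < y j \<longleftrightarrow> y' i < y' j" "x i < y j \<longleftrightarrow> x' i < y' j"
    if "i < k" "j < k" for i j
    using rows that unfolding same_row_def by auto
  show ?thesis
  proof (rule stacking_eqI[OF a.inj b.inj rows])
    show "same_row k z w z' w'" using zw zw' by (simp add: same_row_def)
    show "(x i < z j \<longleftrightarrow> x' i < z' j) \<and> (x i < w j \<longleftrightarrow> x' i < w' j) \<and>
      (y i < z j \<longleftrightarrow> y' i < z' j) \<and> (y i < w j \<longleftrightarrow> y' i < w' j)" if "i < k" "j < k" for i j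
      using that by (simp add: a.cross_less_iff b.cross_less_iff zw zw' xy yx)
  qed
qed

lemma antiparallel_coded:
  assumes "antiparallel_rows k x y z w"
  shows "\<exists>c\<in>{(c, d). c \<in> codes k \<and> d \<in> codes k \<and> fst c = fst d}. has_code k (-1) x y z w c"
proof -
  interpret antiparallel_rows k x y z w by fact
  have "k > 0" using k by simp
  from upper.ex_code[OF this] lower.ex_code[OF this] same_apex
  show ?thesis unfolding has_code_def by fastforce
qed


text \<open>The horizontal creases of the left block join offset \<open>p\<close> to
  \<open>r\<close>, those of the right block \<open>q\<close> to \<open>s\<close>. The four offsets
  are 4, 8, 12, 16 in an order for which these two groups are nested if \<open>b = e\<close> and
  side by side otherwise. The crease of the apex, from 0 to \<open>20 * N\<close>, encloses
  everything.\<close>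

lemma antiparallel_realised:
  assumes "(m, b) \<in> codes k" "(m, e) \<in> codes k" and k: "k \<ge> 2"
  shows "\<exists>x y z w. antiparallel_rows k x y z w \<and> has_code k (-1) x y z w ((m, b), (m, e))"
proof -
  have m: "m < k" using assms by (auto simp: codes_def)
  define N where "N = int k + 1"
  \<comment> \<open>the offsets of the left and right block in the upper (\<open>p\<close>, \<open>q\<close>) and in the lower row (\<open>r\<close>, \<open>s\<close>)\<close>
  define p q r s :: int where
    "p = (if b then 4 else if e then 12 else 8)" and "q = (if b then if e then 8 else 12 else 4)" and
    "r = (if e then 16 else if b then 8 else 12)" and "s = (if e then if b then 12 else 8 else 16)"
  define x where "x = (\<lambda>i. if i < m then p * N - int i - 1 else if i = m then 0 else q * N + int i - N)"
  define y where "y = (\<lambda>i. if i < m then p * N + int i + 1 else q * N + N - int i)"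
  define z where "z = (\<lambda>i. if i < m then r * N + int i + 1 else if i = m then 20 * N else s * N + N - int i)"
  define w where "w = (\<lambda>i. if i < m then r * N - int i - 1 else s * N + int i - N)"
  note defs = x_def y_def z_def w_def p_def q_def r_def s_def
  have bound: "0 < N" "\<And>i. i < k \<Longrightarrow> int i + 1 < N" using k by (auto simp: N_def)
  have less: "i < k \<Longrightarrow> x i < z i" "i < k \<Longrightarrow> y i < w i" "i < k \<Longrightarrow> x i < y i" "i < k \<Longrightarrow> w i < z i"
    "Suc i < k \<Longrightarrow> x (Suc i) < y i" "Suc i < k \<Longrightarrow> w i < z (Suc i)" for i
    using bound(1) bound(2)[of i] bound(2)[of "Suc i"] by (cases b; cases e; simp add: defs)+
  have "directed (Word Mountain Valley Mountain Mountain Mountain Mountain) k x y z w"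
    using less by simp
  moreover have "inj_on (heights x y z w) (faces k)"
    unfolding inj_on_heights_iff
  proof (intro allI impI)
    fix i j assume ij: "i < k" "j < k"
    show "(x i = x j \<longrightarrow> i = j) \<and> (y i = y j \<longrightarrow> i = j) \<and> (z i = z j \<longrightarrow> i = j) \<and> (w i = w j \<longrightarrow> i = j) \<and>
      x i \<noteq> y j \<and> x i \<noteq> z j \<and> x i \<noteq> w j \<and> y i \<noteq> z j \<and> y i \<noteq> w j \<and> z i \<noteq> w j"
      using bound(1) bound(2)[OF ij(1)] bound(2)[OF ij(2)]
      by (cases b; cases e; cases i m rule: linorder_cases; cases j m rule: linorder_cases; simp add: defs)
  qed
  moreover have "laminar k x y z w"
    unfolding laminar_def
  proof (intro conjI allI impI)
    fix i j assume ij: "i < k" "j < k"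
    note bnd = bound(1) bound(2)[OF ij(1)] bound(2)[OF ij(2)]
    have "nc (x i) (z i) (x j) (z j)" "nc (y i) (w i) (y j) (w j)" "nc (x i) (z i) (y j) (w j)"
        "nc (x i) (y i) (x j) (y j)" "nc (w i) (z i) (w j) (z j)" "nc (x i) (y i) (w j) (z j)"
      unfolding nc_def using bnd
      by (cases b; cases e; cases i m rule: linorder_cases; cases j m rule: linorder_cases; simp add: defs)+
    then show "ncu (x i) (z i) (x j) (z j)" "ncu (y i) (w i) (y j) (w j)" "ncu (x i) (z i) (y j) (w j)"
        "ncu (x i) (y i) (x j) (y j)" "ncu (z i) (w i) (z j) (w j)" "ncu (x i) (y i) (z j) (w j)"
      by (simp_all add: ij less ncu_ordered ncu_commute(1)[of "z i" "w i"] ncu_commute(2)[of _ _ "z j" "w j"])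
  next
    fix i j assume ij: "Suc i < k" "Suc j < k"
    note bnd = bound(1) bound(2)[OF ij(1)] bound(2)[OF ij(2)]
    have "nc (x (Suc i)) (y i) (x (Suc j)) (y j)" "nc (w i) (z (Suc i)) (w j) (z (Suc j))"
        "nc (x (Suc i)) (y i) (w j) (z (Suc j))"
      unfolding nc_def using bnd
      by (cases b; cases e; cases "Suc i" m rule: linorder_cases; cases "Suc j" m rule: linorder_cases;
          simp add: defs)+
    then show "ncu (x (Suc i)) (y i) (x (Suc j)) (y j)" "ncu (z (Suc i)) (w i) (z (Suc j)) (w j)"
        "ncu (x (Suc i)) (y i) (z (Suc j)) (w j)"
      by (simp_all add: ij less ncu_ordered ncu_commute(1)[of "z (Suc i)" "w i"]
          ncu_commute(2)[of _ _ "z (Suc j)" "w j"])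
  qed
  moreover have "has_code k (-1) x y z w ((m, b), (m, e))"
    unfolding has_code_def same_row_def
  proof (intro conjI allI impI)
    fix i j assume ij: "i < k" "j < k"
    note bnd = m bound(1) bound(2)[OF ij(1)] bound(2)[OF ij(2)]
    have N: "int k + 1 = N" by (simp add: N_def)
    show "x i < x j \<longleftrightarrow> code_x k (fst ((m, b), m, e)) i < code_x k (fst ((m, b), m, e)) j"
      "y i < y j \<longleftrightarrow> code_y k (fst ((m, b), m, e)) i < code_y k (fst ((m, b), m, e)) j"
      "x i < y j \<longleftrightarrow> code_x k (fst ((m, b), m, e)) i < code_y k (fst ((m, b), m, e)) j"
      "- 1 * z i < - 1 * z j \<longleftrightarrow> code_x k (snd ((m, b), m, e)) i < code_x k (snd ((m, b), m, e)) j"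
      "- 1 * w i < - 1 * w j \<longleftrightarrow> code_y k (snd ((m, b), m, e)) i < code_y k (snd ((m, b), m, e)) j"
      "- 1 * z i < - 1 * w j \<longleftrightarrow> code_x k (snd ((m, b), m, e)) i < code_y k (snd ((m, b), m, e)) j"
      unfolding fst_conv snd_conv code_x.simps code_y.simps N unfolding defs using bnd
      by (cases b; cases e; cases i m rule: linorder_cases; cases j m rule: linorder_cases; auto)+
  qed
  ultimately show ?thesis
    using k by (auto simp: antiparallel_rows_def)
qed

section \<open>Rows pleated in the same direction\<close>

text \<open>Here \<open>x i < z i < w i < y i\<close>: horizontal creases start in the upper row at
  odd columns and in the lower row at even ones. Hence \<open>nc_less_iff\<close> settles only
  comparisons between columns of equal parity.\<close>

locale parallel_rows =
  fixes k :: nat and x y z w :: "nat \<Rightarrow> int"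
  assumes k: "k \<ge> 2"
    and inj: "inj_on (heights x y z w) (faces k)"
    and directed: "directed (Word Mountain Mountain Mountain Mountain Valley Valley) k x y z w"
    and laminar: "laminar k x y z w"
begin

lemma less:
  "i < k \<Longrightarrow> x i < z i" "i < k \<Longrightarrow> w i < y i" "i < k \<Longrightarrow> x i < y i" "i < k \<Longrightarrow> z i < w i"
  "Suc i < k \<Longrightarrow> x (Suc i) < y i" "Suc i < k \<Longrightarrow> z (Suc i) < w i"
  using directed by auto

lemma nc_Hor:
  assumes "i < k" "j < k"
  shows "nc (x i) (z i) (x j) (z j)" "nc (w i) (y i) (w j) (y j)" "nc (x i) (z i) (w j) (y j)"
proof -
  have "ncu (x i) (z i) (x j) (z j)" "ncu (y i) (w i) (y j) (w j)" "ncu (x i) (z i) (y j) (w j)"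
    using laminar assms unfolding laminar_def by blast+
  then show "nc (x i) (z i) (x j) (z j)" "nc (w i) (y i) (w j) (y j)" "nc (x i) (z i) (w j) (y j)"
    using assms by (simp_all add: ncu_ordered less ncu_commute(1)[of "y i" "w i"] ncu_commute(2)[of _ _ "y j" "w j"])
qed

lemma nc_Up:
  "\<lbrakk>i < k; j < k\<rbrakk> \<Longrightarrow> nc (x i) (y i) (x j) (y j)"
  "\<lbrakk>Suc i < k; Suc j < k\<rbrakk> \<Longrightarrow> nc (x (Suc i)) (y i) (x (Suc j)) (y j)"
  using laminar less(3,5) unfolding laminar_def by (metis ncu_ordered)+

lemma nc_Low:
  "\<lbrakk>i < k; j < k\<rbrakk> \<Longrightarrow> nc (z i) (w i) (z j) (w j)"
  "\<lbrakk>Suc i < k; Suc j < k\<rbrakk> \<Longrightarrow> nc (z (Suc i)) (w i) (z (Suc j)) (w j)"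
  using laminar less(4,6) unfolding laminar_def by (metis ncu_ordered)+

sublocale upper: pleated_row k x y
  using inj by unfold_locales (simp_all add: inj_on_heights_iff less nc_Up)

sublocale lower: pleated_row k z w
  using inj by unfold_locales (simp_all add: inj_on_heights_iff less nc_Low)

lemma same_side_less_iff:
  assumes "i < k" "j < k"
  shows "x i < z j \<longleftrightarrow> \<not> (x j < x i \<and> z j < z i)" "w i < y j \<longleftrightarrow> \<not> (w j < w i \<and> y j < y i)"
  by (rule nc_less_iff; simp add: assms nc_Hor less)+

text \<open>A spiral puts all \<open>x\<close> before all \<open>y\<close>, with \<open>x\<close>
  monotone in the index and \<open>y\<close> monotone in the opposite sense. The premise
  \<open>w j < z i\<close> makes the two columns nonadjacent, and either sense of the spiral then
  gives one of the alternatives.\<close>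

lemma spiral_nested:
  assumes c: "c = (0, True) \<or> c = (k - 1, True)"
    and code: "same_row k x y (code_x k c) (code_y k c)"
    and ij: "i < k" "j < k" and xy: "x i < y j" and wz: "w j < z i"
  shows "(x i < x j \<or> Suc j < k \<and> x i < x (Suc j)) \<or> (y i < y j \<or> 0 < i \<and> y (i - 1) < y j)"
proof -
  have "i \<noteq> j" using wz less(4)[of i] ij by auto
  moreover have "i \<noteq> Suc j" using wz less(6)[of j] ij by auto
  ultimately consider "i < j" | l where "i = Suc l" "j < l" by (cases i) force+
  then show ?thesis
  proof cases
    case 1
    then have "x i < x j \<or> y i < y j"
      using c code ij unfolding same_row_def by (auto split: if_splits)
    then show ?thesis by blast
  next
    case 2
    then have "x i < x (Suc j) \<or> y l < y j"
      using c code ij unfolding same_row_def by (auto split: if_splits)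
    then show ?thesis using 2 ij by auto
  qed
qed

lemma nested_cases:
  assumes code: "has_code k 1 x y z w (c, d)" and cd: "c = (0, True) \<or> c = (k - 1, True) \<or> c = d"
    and ij: "i < k" "j < k" and xy: "x i < y j" and wz: "w j < z i"
  shows "(x i < x j \<or> Suc j < k \<and> x i < x (Suc j)) \<or> (y i < y j \<or> 0 < i \<and> y (i - 1) < y j)"
proof -
  have "c \<noteq> d"
  proof
    assume "c = d"
    then have "z i < w j \<longleftrightarrow> x i < y j"
      using code ij unfolding has_code_def same_row_def by simp
    with xy wz show False by simp
  qed
  then show ?thesis using spiral_nested[OF _ _ ij xy wz] code cd unfolding has_code_def by simp
qed

text \<open>If \<open>x i < y j\<close> and \<open>w j < z i\<close>, the creases from
  \<open>x i\<close> to \<open>z i\<close> and from \<open>w j\<close> to \<open>y j\<close>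
  overlap, so one contains the other. An \<open>x\<close> of column pair \<open>j\<close> or
  \<open>Suc j\<close> after \<open>x i\<close> forces \<open>x i < w j\<close>, since that
  \<open>x\<close> precedes \<open>w j\<close>; dually, a \<open>y\<close> of pair \<open>i\<close>
  or \<open>i - 1\<close> before \<open>y j\<close> forces \<open>z i < y j\<close>. These exclude
  each other, and the premise says that one occurs.\<close>

lemma opposite_side_less_iff:
  assumes nested: "x i < y j \<Longrightarrow> w j < z i \<Longrightarrow>
      (x i < x j \<or> Suc j < k \<and> x i < x (Suc j)) \<or> (y i < y j \<or> 0 < i \<and> y (i - 1) < y j)"
    and ij: "i < k" "j < k"
  shows "x i < w j \<longleftrightarrow> x i < y j \<and> (z i < w j \<or> x i < x j \<or> Suc j < k \<and> x i < x (Suc j))"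
    "z i < y j \<longleftrightarrow> x i < y j \<and> (z i < w j \<or> \<not> (x i < x j \<or> Suc j < k \<and> x i < x (Suc j)))"
proof -
  have l: "x i < z i" "w j < y j" "z i \<noteq> w j" using less ij lower.x_neq_y by auto
  have Q: "x i < w j" if "x i < x j \<or> Suc j < k \<and> x i < x (Suc j)"
    using that less(1)[of j] less(4)[of j] less(1)[of "Suc j"] less(6)[of j] ij by auto
  have Q': "z i < y j" if "y i < y j \<or> 0 < i \<and> y (i - 1) < y j"
    using that less(2)[of i] less(4)[of i] less(2)[of "i - 1"] less(6)[of "i - 1"] ij
    by (cases i) auto
  have nc: "\<not> (x i < w j \<and> w j < z i \<and> z i < y j)" using nc_Hor(3)[OF ij] by (auto simp: nc_def)
  show "x i < w j \<longleftrightarrow> x i < y j \<and> (z i < w j \<or> x i < x j \<or> Suc j < k \<and> x i < x (Suc j))"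
    using l Q Q' nc nested by linarith
  show "z i < y j \<longleftrightarrow> x i < y j \<and> (z i < w j \<or> \<not> (x i < x j \<or> Suc j < k \<and> x i < x (Suc j)))"
    using l Q Q' nc nested by linarith
qed

text \<open>The order of the two blocks of the upper row forces the same order of \<open>w (m - 1)\<close> and \<open>w m\<close> in the lower
  row. If the apices \<open>m\<close> and \<open>n\<close> differ and the block of the upper row that misses \<open>n\<close> comes second, this
  contradicts the order inside the lower block that contains both. If it comes first, it lies before
  \<open>x n\<close>, hence inside the horizontal crease of \<open>m\<close>, and so does the lower face adjacent to \<open>z m\<close>, which
  has to follow \<open>z m\<close>.\<close>

lemma spiral_or_same_code:
  assumes c: "c \<in> codes k" "same_row k x y (code_x k c) (code_y k c)"
    and d: "d \<in> codes k" "same_row k z w (code_x k d) (code_y k d)"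
  shows "c = (0, True) \<or> c = (k - 1, True) \<or> c = d"
proof (rule ccontr)
  assume contra: "\<not> ?thesis"
  obtain m b where c': "c = (m, b)" by fastforce
  obtain n e where d': "d = (n, e)" by fastforce
  have mn: "m < k" "n < k" using k c d by (auto simp: codes_def c' d')
  have nonspiral: "m \<noteq> 0" "\<not> b \<or> Suc m < k" using contra c mn by (auto simp: codes_def c')
  then obtain p where p: "m = Suc p" by (cases m) auto
  have pk: "p < k" "Suc p < k" using mn p by auto
  have X: "x i < x j" if "code_x k (m, b) i < code_x k (m, b) j" "i < k" "j < k" for i j
    using that c unfolding same_row_def c' by blast
  have YX: "y j < x i" if "code_y k (m, b) j < code_x k (m, b) i" "i < k" "j < k" for i j
  proof -
    have "\<not> code_x k (m, b) i < code_y k (m, b) j" using that by linarith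
    then have "\<not> x i < y j" using that c unfolding same_row_def c' by blast
    then show ?thesis using upper.x_neq_y[of i j] that by simp
  qed
  have Z: "z i < z j" if "code_x k (n, e) i < code_x k (n, e) j" "i < k" "j < k" for i j
    using that d unfolding same_row_def d' by blast
  have W: "w i < w j" if "code_y k (n, e) i < code_y k (n, e) j" "i < k" "j < k" for i j
    using that d unfolding same_row_def d' by blast
  have 1: "w p < w m" if b
  proof -
    have "Suc m < k" using nonspiral that by auto
    then have "y p < x (Suc m)" by (intro YX) (use that mn p in auto)
    then show ?thesis using less(2)[OF pk(1)] less(1,6)[of "Suc m"] less(6)[of m] \<open>Suc m < k\<close> by auto
  qed
  have 2: "w m < w p" if "\<not> b"
  proof -
    have "y m < x p" by (intro YX) (use that mn p in auto)
    then show ?thesis using less(2)[OF mn(1)] less(1,4)[OF pk(1)] by auto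
  qed
  note crease = less
  show False
  proof (cases m n rule: linorder_cases)
    case equal
    then have "b \<noteq> e" using contra by (auto simp: c' d')
    then show False
      using 1 2 W[of m p] W[of p m] equal p mn by (cases b) auto
  next
    case less
    show False
    proof (cases b)
      case True
      have zx: "z n < z m" by (rule Z[OF _ mn(2,1)]) (use less mn in \<open>cases e; auto\<close>)
      have "y p < x n" by (rule YX) (use True less mn p in auto)
      with zx have "w p < z m"
        using crease(1)[OF mn(2)] crease(2)[OF pk(1)] by simp
      moreover have "z m < w p" using crease(6)[OF pk(2)] p by simp
      ultimately show False by simp
    next
      case False
      have "w p < w m" by (rule W[OF _ pk(1) mn(1)]) (use less mn p in \<open>cases e; auto\<close>)
      with 2 False show False by simp
    qed
  next
    case greater
    show False
    proof (cases b)
      case True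
      then have "Suc m < k" using nonspiral by simp
      have "w m < w p" by (rule W[OF _ mn(1) pk(1)]) (use greater mn p in \<open>cases e; auto\<close>)
      with 1 True show False by simp
    next
      case False
      have zx: "z n < z m" by (rule Z[OF _ mn(2,1)]) (use greater mn in \<open>cases e; auto\<close>)
      have "y m < x n" by (rule YX) (use False greater mn p in auto)
      with zx have "w m < z m"
        using crease(1)[OF mn(2)] crease(2)[OF mn(1)] by simp
      moreover have "z m < w m" using crease(4)[OF mn(1)] by simp
      ultimately show False by simp
    qed
  qed
qed

end

lemma parallel_coded:
  assumes "parallel_rows k x y z w"
  shows "\<exists>c\<in>{(c, d). c \<in> codes k \<and> d \<in> codes k \<and> (c = (0, True) \<or> c = (k - 1, True) \<or> c = d)}.
    has_code k 1 x y z w c"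
proof -
  interpret parallel_rows k x y z w by fact
  have "k > 0" using k by simp
  from upper.ex_code[OF this] lower.ex_code[OF this] spiral_or_same_code
  show ?thesis unfolding has_code_def by fastforce
qed

text \<open>The right-hand sides of \<open>same_side_less_iff\<close> and
  \<open>opposite_side_less_iff\<close> compare only faces of one row, and those comparisons are
  fixed by the code.\<close>

lemma parallel_determined:
  assumes "parallel_rows k x y z w" "parallel_rows k x' y' z' w'"
    "has_code k 1 x y z w (c, d)" "has_code k 1 x' y' z' w' (c, d)"
    and cd: "c = (0, True) \<or> c = (k - 1, True) \<or> c = d"
  shows "stacking k (heights x y z w) = stacking k (heights x' y' z' w')"
proof -
  interpret a: parallel_rows k x y z w by fact
  interpret b: parallel_rows k x' y' z' w' by fact
  have xy: "same_row k x y x' y'" and zw: "same_row k z w z' w'"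
    using assms(3,4) unfolding has_code_def by (auto intro: same_row_trans)
  have nested_a: "(x i < x j \<or> Suc j < k \<and> x i < x (Suc j)) \<or> (y i < y j \<or> 0 < i \<and> y (i - 1) < y j)"
    if "x i < y j" "w j < z i" "i < k" "j < k" for i j
    using a.nested_cases[OF assms(3) cd] that by blast
  have nested_b: "(x' i < x' j \<or> Suc j < k \<and> x' i < x' (Suc j)) \<or> (y' i < y' j \<or> 0 < i \<and> y' (i - 1) < y' j)"
    if "x' i < y' j" "w' j < z' i" "i < k" "j < k" for i j
    using b.nested_cases[OF assms(4) cd] that by blast
  have xy': "x i < x j \<longleftrightarrow> x' i < x' j" "y i < y j \<longleftrightarrow> y' i < y' j" "x i < y j \<longleftrightarrow> x' i < y' j"
    "z i < z j \<longleftrightarrow> z' i < z' j" "w i < w j \<longleftrightarrow> w' i < w' j" "z i < w j \<longleftrightarrow> z' i < w' j"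
    if "i < k" "j < k" for i j
    using xy zw that unfolding same_row_def by blast+
  have same: "x i < z j \<longleftrightarrow> x' i < z' j" "w i < y j \<longleftrightarrow> w' i < y' j" if "i < k" "j < k" for i j
    using that by (simp_all add: a.same_side_less_iff b.same_side_less_iff xy')
  have opp: "x i < w j \<longleftrightarrow> x' i < w' j" "z i < y j \<longleftrightarrow> z' i < y' j" if ij: "i < k" "j < k" for i j
    using a.opposite_side_less_iff[OF nested_a[OF _ _ ij] ij] b.opposite_side_less_iff[OF nested_b[OF _ _ ij] ij]
      xy'[OF ij] xy'(1)[of i "Suc j"] ij by blast+
  have neq: "y i \<noteq> z j" "y i \<noteq> w j" "y' i \<noteq> z' j" "y' i \<noteq> w' j" if "i < k" "j < k" for i j
    using a.inj b.inj that unfolding inj_on_heights_iff by blast+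
  show ?thesis
  proof (rule stacking_eqI[OF a.inj b.inj xy zw])
    fix i j assume ij: "i < k" "j < k"
    have "y i < z j \<longleftrightarrow> \<not> z j < y i" "y' i < z' j \<longleftrightarrow> \<not> z' j < y' i"
      "y i < w j \<longleftrightarrow> \<not> w j < y i" "y' i < w' j \<longleftrightarrow> \<not> w' j < y' i"
      using neq[OF ij] by linarith+
    then show "(x i < z j \<longleftrightarrow> x' i < z' j) \<and> (x i < w j \<longleftrightarrow> x' i < w' j) \<and>
      (y i < z j \<longleftrightarrow> y' i < z' j) \<and> (y i < w j \<longleftrightarrow> y' i < w' j)"
      using same[OF ij] same[OF ij(2,1)] opp[OF ij] opp[OF ij(2,1)] by blast
  qed
qed

text \<open>Every upper face is put next to the lower face of its column, except that in the spiral case \<open>l\<close>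
  (resp. \<open>r\<close>) the upper faces left (resp. right) of the apex are moved outside of everything else.\<close>

lemma parallel_realised:
  assumes "(m, b) \<in> codes k" and k: "k \<ge> 2" and lr: "\<not> (l \<and> r)"
  shows "\<exists>x y z w. parallel_rows k x y z w \<and>
    has_code k 1 x y z w (if l then (0, True) else if r then (k - 1, True) else (m, b), (m, b))"
proof -
  have m: "m < k" using assms by (auto simp: codes_def)
  define c where "c = (if l then (0, True) else if r then (k - 1, True) else (m, b))"
  define N where "N = int k + 1"
  \<comment> \<open>The slope 2 leaves a gap beside each lower face for its upper neighbour. Both
    blocks, centred at 0 and \<open>q * N\<close>, stay strictly between \<open>-15 * N\<close> and
    \<open>15 * N\<close>; the apices sit at the lower bound, and the moved faces lie around
    \<open>-20 * N\<close> and \<open>20 * N\<close>.\<close>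
  define q :: int where "q = (if b then 8 else - 8)"
  define x where "x = (\<lambda>i. if i < m then if l then int i - 20 * N else - 2 * int i - 3
    else if i = m then - 15 * N - 1 else if r then - 20 * N - int i else q * N + 2 * int i - 2 * N - 1)"
  define y where "y = (\<lambda>i. if i < m then if l then 20 * N - int i else 2 * int i + 3
    else if r then 20 * N + int i else q * N + 2 * N - 2 * int i + 1)"
  define z where "z = (\<lambda>i. if i < m then - 2 * int i - 2
    else if i = m then - 15 * N else q * N + 2 * int i - 2 * N)"
  define w where "w = (\<lambda>i. if i < m then 2 * int i + 2 else q * N + 2 * N - 2 * int i)"
  note defs = x_def y_def z_def w_def q_def
  have bound: "0 < N" "\<And>i. i < k \<Longrightarrow> int i + 1 < N" using k by (auto simp: N_def)
  have less: "i < k \<Longrightarrow> x i < z i" "i < k \<Longrightarrow> w i < y i" "i < k \<Longrightarrow> x i < y i" "i < k \<Longrightarrow> z i < w i"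
    "Suc i < k \<Longrightarrow> x (Suc i) < y i" "Suc i < k \<Longrightarrow> z (Suc i) < w i" for i
    using bound(1) bound(2)[of i] bound(2)[of "Suc i"] lr by (cases b; cases l; cases r; simp add: defs)+
  have "directed (Word Mountain Mountain Mountain Mountain Valley Valley) k x y z w"
    using less by simp
  moreover have "inj_on (heights x y z w) (faces k)"
    unfolding inj_on_heights_iff
  proof (intro allI impI)
    fix i j assume ij: "i < k" "j < k"
    show "(x i = x j \<longrightarrow> i = j) \<and> (y i = y j \<longrightarrow> i = j) \<and> (z i = z j \<longrightarrow> i = j) \<and> (w i = w j \<longrightarrow> i = j) \<and>
      x i \<noteq> y j \<and> x i \<noteq> z j \<and> x i \<noteq> w j \<and> y i \<noteq> z j \<and> y i \<noteq> w j \<and> z i \<noteq> w j"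
      using bound(1) bound(2)[OF ij(1)] bound(2)[OF ij(2)] lr
      by (cases b; cases l; cases r; cases i m rule: linorder_cases; cases j m rule: linorder_cases;
          simp add: defs; presburger?)
  qed
  moreover have "laminar k x y z w"
    unfolding laminar_def
  proof (intro conjI allI impI)
    fix i j assume ij: "i < k" "j < k"
    note bnd = bound(1) bound(2)[OF ij(1)] bound(2)[OF ij(2)]
    have "nc (x i) (z i) (x j) (z j)" "nc (w i) (y i) (w j) (y j)" "nc (x i) (z i) (w j) (y j)"
        "nc (x i) (y i) (x j) (y j)" "nc (z i) (w i) (z j) (w j)" "nc (x i) (y i) (z j) (w j)"
      unfolding nc_def using bnd lr
      by (cases b; cases l; cases r; cases i m rule: linorder_cases; cases j m rule: linorder_cases;
          simp add: defs)+
    then show "ncu (x i) (z i) (x j) (z j)" "ncu (y i) (w i) (y j) (w j)" "ncu (x i) (z i) (y j) (w j)"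
        "ncu (x i) (y i) (x j) (y j)" "ncu (z i) (w i) (z j) (w j)" "ncu (x i) (y i) (z j) (w j)"
      by (simp_all add: ij less ncu_ordered ncu_commute(1)[of "y i" "w i"] ncu_commute(2)[of _ _ "y j" "w j"])
  next
    fix i j assume ij: "Suc i < k" "Suc j < k"
    note bnd = bound(1) bound(2)[OF ij(1)] bound(2)[OF ij(2)]
    have "nc (x (Suc i)) (y i) (x (Suc j)) (y j)" "nc (z (Suc i)) (w i) (z (Suc j)) (w j)"
        "nc (x (Suc i)) (y i) (z (Suc j)) (w j)"
      unfolding nc_def using bnd lr
      by (cases b; cases l; cases r; cases "Suc i" m rule: linorder_cases; cases "Suc j" m rule: linorder_cases;
          simp add: defs)+
    then show "ncu (x (Suc i)) (y i) (x (Suc j)) (y j)" "ncu (z (Suc i)) (w i) (z (Suc j)) (w j)"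
        "ncu (x (Suc i)) (y i) (z (Suc j)) (w j)"
      by (simp_all add: ij less ncu_ordered)
  qed
  moreover have "has_code k 1 x y z w (c, (m, b))"
    unfolding has_code_def fst_conv snd_conv
  proof
    have N: "int k + 1 = N" by (simp add: N_def)
    obtain K where K: "k - 1 = K" "k = Suc K" using k by (cases k) auto
    consider l "\<not> r" "c = (0, True)" | r "\<not> l" "c = (K, True)" | "\<not> l" "\<not> r" "c = (m, b)"
      using lr by (auto simp: c_def K)
    then show "same_row k x y (code_x k c) (code_y k c)"
    proof cases
      case 1
      show ?thesis
        unfolding same_row_def 1(3)
      proof (intro conjI allI impI)
        fix i j assume ij: "i < k" "j < k"
        show "x i < x j \<longleftrightarrow> code_x k (0, True) i < code_x k (0, True) j"
          "y i < y j \<longleftrightarrow> code_y k (0, True) i < code_y k (0, True) j"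
          "x i < y j \<longleftrightarrow> code_x k (0, True) i < code_y k (0, True) j"
          using bound(1) bound(2)[OF ij(1)] bound(2)[OF ij(2)] 1(1,2)
          by (cases b; cases i m rule: linorder_cases; cases j m rule: linorder_cases; cases "i = 0"; cases "j = 0";
              simp add: defs N; linarith?)+
      qed
    next
      case 2
      show ?thesis
        unfolding same_row_def 2(3)
      proof (intro conjI allI impI)
        fix i j assume ij: "i < k" "j < k"
        show "x i < x j \<longleftrightarrow> code_x k (K, True) i < code_x k (K, True) j"
          "y i < y j \<longleftrightarrow> code_y k (K, True) i < code_y k (K, True) j"
          "x i < y j \<longleftrightarrow> code_x k (K, True) i < code_y k (K, True) j"
          using bound(1) bound(2)[OF ij(1)] bound(2)[OF ij(2)] 2(1,2) ij m unfolding K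
          by (cases b; cases i m rule: linorder_cases; cases j m rule: linorder_cases; cases "i = K"; cases "j = K";
              simp add: defs N; linarith?)+
      qed
    next
      case 3
      show ?thesis
        unfolding same_row_def 3(3)
      proof (intro conjI allI impI)
        fix i j assume ij: "i < k" "j < k"
        show "x i < x j \<longleftrightarrow> code_x k (m, b) i < code_x k (m, b) j"
          "y i < y j \<longleftrightarrow> code_y k (m, b) i < code_y k (m, b) j"
          "x i < y j \<longleftrightarrow> code_x k (m, b) i < code_y k (m, b) j"
          using bound(1) bound(2)[OF ij(1)] bound(2)[OF ij(2)] 3(1,2)
          by (cases b; cases i m rule: linorder_cases; cases j m rule: linorder_cases;
              simp add: defs N; linarith?)+
      qed
    qed
    show "same_row k (\<lambda>i. 1 * z i) (\<lambda>i. 1 * w i) (code_x k (m, b)) (code_y k (m, b))"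
      unfolding same_row_def mult_1
    proof (intro conjI allI impI)
      fix i j assume ij: "i < k" "j < k"
      show "z i < z j \<longleftrightarrow> code_x k (m, b) i < code_x k (m, b) j"
        "w i < w j \<longleftrightarrow> code_y k (m, b) i < code_y k (m, b) j"
        "z i < w j \<longleftrightarrow> code_x k (m, b) i < code_y k (m, b) j"
        using bound(1) bound(2)[OF ij(1)] bound(2)[OF ij(2)]
        by (cases b; cases i m rule: linorder_cases; cases j m rule: linorder_cases;
            simp add: defs N; linarith?)+
    qed
  qed
  ultimately show ?thesis
    using k unfolding parallel_rows_def c_def by blast
qed

section \<open>The counts\<close>

lemma card_codes: "k \<ge> 1 \<Longrightarrow> card (codes k) = 2 * k - 1"
  by (auto simp: codes_def card_insert_if card_cartesian_product)

lemma card_same_apex: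
  assumes "k \<ge> 1"
  shows "card {(c, d). c \<in> codes k \<and> d \<in> codes k \<and> fst c = fst d} = 4 * k - 3"
proof -
  let ?f = "\<lambda>(m :: nat, b :: bool, e :: bool). ((m, b), (m, e))"
  have "{(c, d). c \<in> codes k \<and> d \<in> codes k \<and> fst c = fst d} =
      insert ((0, True), (0, True)) (?f ` ({1..<k} \<times> UNIV \<times> UNIV))"
    by (auto simp: codes_def image_iff)
  moreover have "card (?f ` ({1..<k} \<times> UNIV \<times> UNIV)) = 4 * (k - 1)"
    by (subst card_image) (auto simp: inj_on_def card_cartesian_product simp del: UNIV_Times_UNIV)
  moreover have "((0, True), (0, True)) \<notin> ?f ` ({1..<k} \<times> UNIV \<times> UNIV)" by auto
  ultimately show ?thesis using assms by simp
qed

lemma card_spiral_or_same: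
  assumes "k \<ge> 2"
  shows "card {(c, d). c \<in> codes k \<and> d \<in> codes k \<and> (c = (0, True) \<or> c = (k - 1, True) \<or> c = d)} = 6 * k - 5"
proof -
  let ?S = "{(0, True), (k - 1, True)}"
  have S: "?S \<subseteq> codes k" "card ?S = 2" using assms by (auto simp: codes_def)
  have fin: "finite (codes k)" by (simp add: codes_def)
  have "{(c, d). c \<in> codes k \<and> d \<in> codes k \<and> (c = (0, True) \<or> c = (k - 1, True) \<or> c = d)} =
      (\<lambda>c. (c, c)) ` (codes k - ?S) \<union> ?S \<times> codes k"
    using S by auto
  also have "card \<dots> = card ((\<lambda>c. (c, c)) ` (codes k - ?S)) + card (?S \<times> codes k)"
    by (rule card_Un_disjoint) (use fin in auto)
  also have "card ((\<lambda>c. (c, c)) ` (codes k - ?S)) = card (codes k) - 2"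
    using S by (subst card_image) (auto simp: inj_on_def card_Diff_subset)
  also have "card (?S \<times> codes k) = 2 * card (codes k)"
    using S by (simp add: card_cartesian_product del: card_insert_disjoint)
  finally show ?thesis using assms by (simp add: card_codes)
qed

lemma folding_count_antiparallel:
  assumes k: "k \<ge> 2"
  shows "folding_count (Word Mountain Valley Mountain Mountain Mountain Mountain) k = 4 * k - 3"
proof -
  let ?C = "{(c, d). c \<in> codes k \<and> d \<in> codes k \<and> fst c = fst d}"
  have "folding_count (Word Mountain Valley Mountain Mountain Mountain Mountain) k = card ?C"
  proof (rule folding_count_eq_card_codes[OF k, where s = "-1"])
    fix c assume "c \<in> ?C"
    then obtain m b e where "c = ((m, b), (m, e))" "(m, b) \<in> codes k" "(m, e) \<in> codes k" by auto
    then show "\<exists>x y z w. inj_on (heights x y z w) (faces k) \<and>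
      directed (Word Mountain Valley Mountain Mountain Mountain Mountain) k x y z w \<and>
      laminar k x y z w \<and> has_code k (- 1) x y z w c"
      using antiparallel_realised[of m b k e] k unfolding antiparallel_rows_def by blast
  next
    fix x y z w
    assume "inj_on (heights x y z w) (faces k)"
      "directed (Word Mountain Valley Mountain Mountain Mountain Mountain) k x y z w" "laminar k x y z w"
    then show "\<exists>c\<in>?C. has_code k (- 1) x y z w c"
      by (intro antiparallel_coded antiparallel_rows.intro k)
  qed (simp, simp, simp, blast, intro antiparallel_determined antiparallel_rows.intro k)
  then show ?thesis using card_same_apex k by simp
qed

lemma folding_count_parallel:
  assumes k: "k \<ge> 2"
  shows "folding_count (Word Mountain Mountain Mountain Mountain Valley Valley) k = 6 * k - 5"
proof -
  let ?C = "{(c, d). c \<in> codes k \<and> d \<in> codes k \<and> (c = (0, True) \<or> c = (k - 1, True) \<or> c = d)}"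
  have "folding_count (Word Mountain Mountain Mountain Mountain Valley Valley) k = card ?C"
  proof (rule folding_count_eq_card_codes[OF k, where s = 1])
    fix c assume c: "c \<in> ?C"
    then obtain m b where d: "snd c = (m, b)" "(m, b) \<in> codes k" by (cases "snd c") auto
    from c d have "c = ((0, True), (m, b)) \<or> c = ((k - 1, True), (m, b)) \<or> c = ((m, b), (m, b))" by auto
    then show "\<exists>x y z w. inj_on (heights x y z w) (faces k) \<and>
      directed (Word Mountain Mountain Mountain Mountain Valley Valley) k x y z w \<and>
      laminar k x y z w \<and> has_code k 1 x y z w c"
      using parallel_realised[OF d(2) k, of True False] parallel_realised[OF d(2) k, of False True]
        parallel_realised[OF d(2) k, of False False] unfolding parallel_rows_def by auto
  next
    fix x y z w
    assume "inj_on (heights x y z w) (faces k)"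
      "directed (Word Mountain Mountain Mountain Mountain Valley Valley) k x y z w" "laminar k x y z w"
    then show "\<exists>c\<in>?C. has_code k 1 x y z w c"
      by (intro parallel_coded parallel_rows.intro k)
  next
    fix x y z w x' y' z' w' c
    assume "c \<in> ?C" and tuples: "inj_on (heights x y z w) (faces k)"
      "directed (Word Mountain Mountain Mountain Mountain Valley Valley) k x y z w" "laminar k x y z w"
      "has_code k 1 x y z w c" "inj_on (heights x' y' z' w') (faces k)"
      "directed (Word Mountain Mountain Mountain Mountain Valley Valley) k x' y' z' w'"
      "laminar k x' y' z' w'" "has_code k 1 x' y' z' w' c"
    then obtain p q where "c = (p, q)" "p = (0, True) \<or> p = (k - 1, True) \<or> p = q" by auto
    then show "stacking k (heights x y z w) = stacking k (heights x' y' z' w')"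
      using tuples by (intro parallel_determined[of k _ _ _ _ _ _ _ _ p q] parallel_rows.intro k) auto
  qed auto
  then show ?thesis using card_spiral_or_same[OF k] by simp
qed

section \<open>Words whose precedences already form a chain\<close>

lemma folding_count_eq_1I:
  assumes k: "k \<ge> 2" and delta: "delta0 P = -1" "delta1 P = -1"
    and t: "inj_on (heights x y z w) (faces k)" "directed P k x y z w" "laminar k x y z w"
    and unique: "\<And>x' y' z' w'. inj_on (heights x' y' z' w') (faces k) \<Longrightarrow> directed P k x' y' z' w' \<Longrightarrow>
      stacking k (heights x' y' z' w') = stacking k (heights x y z w)"
  shows "folding_count P k = 1"
proof -
  have "R = stacking k (heights x y z w)" if "R \<in> foldings P k" for R
    using foldings_heights[OF k that] unique by metis
  moreover have "stacking k (heights x y z w) \<in> foldings P k"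
    using stacking_mem_foldings[OF k delta t(1)] t by simp
  ultimately have "foldings P k = {stacking k (heights x y z w)}" by blast
  then show ?thesis by (simp add: folding_count_def)
qed

text \<open>The chain meanders through the columns: down column \<open>2*i + 1\<close>, up column
  \<open>2*i + 2\<close>, and on to the next pair. The witness heights are the positions in this
  chain.\<close>

lemma folding_count_parallel_monotone:
  assumes k: "k \<ge> 2"
  shows "folding_count (Word Mountain Mountain Mountain Valley Valley Mountain) k = 1"
proof (rule folding_count_eq_1I[OF k])
  let ?x = "\<lambda>i. 4 * int i" and ?y = "\<lambda>i. 4 * int i + 3" and ?z = "\<lambda>i. 4 * int i + 1" and ?w = "\<lambda>i. 4 * int i + 2"
  show inj: "inj_on (heights ?x ?y ?z ?w) (faces k)"
    unfolding inj_on_heights_iff by (simp; presburger)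
  show "directed (Word Mountain Mountain Mountain Valley Valley Mountain) k ?x ?y ?z ?w" by simp
  show "laminar k ?x ?y ?z ?w" by (simp add: laminar_def ncu_def nc_def min_def max_def; presburger)
  fix x y z w
  assume inj': "inj_on (heights x y z w) (faces k)"
    and d: "directed (Word Mountain Mountain Mountain Valley Valley Mountain) k x y z w"
  have block: "x i < z i" "z i < w i" "w i < y i" if "i < k" for i using d that by auto
  have next_block: "y i < x (Suc i)" if "Suc i < k" for i using d that by auto
  have x: "x i < x j" if "i < j" "j < k" for i j
  proof (rule strict_mono_upto[of 0 "k - 1"])
    show "x i < x (Suc i)" if "i < k - 1" for i
      proof -
        have "i < k" "Suc i < k" using that by auto
        then show ?thesis using block[of i] next_block[of i] by simp
      qed
  qed (use that in auto)
  have yx: "y i < x j" if "i < j" "j < k" for i j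
    using next_block[of i] x[of "Suc i" j] that by (cases "Suc i = j") auto
  show "stacking k (heights x y z w) = stacking k (heights ?x ?y ?z ?w)"
  proof (rule stacking_eqI[OF inj' inj])
    show "same_row k x y ?x ?y" unfolding same_row_def
    proof (intro allI impI)
      fix i j assume ij: "i < k" "j < k"
      show "(x i < x j \<longleftrightarrow> ?x i < ?x j) \<and> (y i < y j \<longleftrightarrow> ?y i < ?y j) \<and> (x i < y j \<longleftrightarrow> ?x i < ?y j)"
        using block[OF ij(1)] block[OF ij(2)] yx[of i j] yx[of j i] ij
        by (cases i j rule: linorder_cases) auto
    qed
    show "same_row k z w ?z ?w" unfolding same_row_def
    proof (intro allI impI)
      fix i j assume ij: "i < k" "j < k"
      show "(z i < z j \<longleftrightarrow> ?z i < ?z j) \<and> (w i < w j \<longleftrightarrow> ?w i < ?w j) \<and> (z i < w j \<longleftrightarrow> ?z i < ?w j)"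
        using block[OF ij(1)] block[OF ij(2)] yx[of i j] yx[of j i] ij
        by (cases i j rule: linorder_cases) auto
    qed
    fix i j assume ij: "i < k" "j < k"
    show "(x i < z j \<longleftrightarrow> ?x i < ?z j) \<and> (x i < w j \<longleftrightarrow> ?x i < ?w j) \<and>
      (y i < z j \<longleftrightarrow> ?y i < ?z j) \<and> (y i < w j \<longleftrightarrow> ?y i < ?w j)"
      using block[OF ij(1)] block[OF ij(2)] yx[of i j] yx[of j i] ij
      by (cases i j rule: linorder_cases) auto
  qed
qed simp_all

text \<open>The chain runs along the upper row from left to right and returns along the lower
  row.\<close>

lemma folding_count_antiparallel_monotone:
  assumes k: "k \<ge> 2"
  shows "folding_count (Word Mountain Valley Mountain Valley Mountain Valley) k = 1"
proof (rule folding_count_eq_1I[OF k])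
  let ?x = "\<lambda>i. 2 * int i" and ?y = "\<lambda>i. 2 * int i + 1"
  let ?z = "\<lambda>i. 4 * int k - 2 * int i" and ?w = "\<lambda>i. 4 * int k - 2 * int i - 1"
  show inj: "inj_on (heights ?x ?y ?z ?w) (faces k)"
    unfolding inj_on_heights_iff by (simp; presburger)
  show "directed (Word Mountain Valley Mountain Valley Mountain Valley) k ?x ?y ?z ?w" by simp
  show "laminar k ?x ?y ?z ?w" by (simp add: laminar_def ncu_def nc_def min_def max_def; presburger)
  fix x y z w
  assume inj': "inj_on (heights x y z w) (faces k)"
    and d: "directed (Word Mountain Valley Mountain Valley Mountain Valley) k x y z w"
  have block: "x i < y i" "y i < w i" "w i < z i" if "i < k" for i using d that by auto
  have next_block: "y i < x (Suc i)" "z (Suc i) < w i" if "Suc i < k" for i using d that by auto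
  have x: "x i < x j" if "i < j" "j < k" for i j
  proof (rule strict_mono_upto[of 0 "k - 1"])
    show "x i < x (Suc i)" if "i < k - 1" for i
      proof -
        have "i < k" "Suc i < k" using that by auto
        then show ?thesis using block(1)[of i] next_block(1)[of i] by simp
      qed
  qed (use that in auto)
  have yx: "y i < x j" if "i < j" "j < k" for i j
    using next_block[of i] x[of "Suc i" j] that by (cases "Suc i = j") auto
  have z: "z j < z i" if "i < j" "j < k" for i j
  proof -
    have "- z i < - z j"
    proof (rule strict_mono_upto[of 0 "k - 1" "\<lambda>i. - z i"])
      show "- z i < - z (Suc i)" if "i < k - 1" for i
        proof -
        have "i < k" "Suc i < k" using that by auto
        then show ?thesis using block(3)[of i] next_block(2)[of i] by simp
      qed
    qed (use that in auto)
    then show ?thesis by simp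
  qed
  have zw: "z j < w i" if "i < j" "j < k" for i j
    using next_block[of i] z[of "Suc i" j] that by (cases "Suc i = j") auto
  show "stacking k (heights x y z w) = stacking k (heights ?x ?y ?z ?w)"
  proof (rule stacking_eqI[OF inj' inj])
    show "same_row k x y ?x ?y" unfolding same_row_def
    proof (intro allI impI)
      fix i j assume ij: "i < k" "j < k"
      show "(x i < x j \<longleftrightarrow> ?x i < ?x j) \<and> (y i < y j \<longleftrightarrow> ?y i < ?y j) \<and> (x i < y j \<longleftrightarrow> ?x i < ?y j)"
        using block[OF ij(1)] block[OF ij(2)] yx[of i j] yx[of j i] ij
        by (cases i j rule: linorder_cases) auto
    qed
    show "same_row k z w ?z ?w" unfolding same_row_def
    proof (intro allI impI)
      fix i j assume ij: "i < k" "j < k"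
      show "(z i < z j \<longleftrightarrow> ?z i < ?z j) \<and> (w i < w j \<longleftrightarrow> ?w i < ?w j) \<and> (z i < w j \<longleftrightarrow> ?z i < ?w j)"
        using block[OF ij(1)] block[OF ij(2)] zw[of i j] zw[of j i] ij
        by (cases i j rule: linorder_cases) auto
    qed
    fix i j assume ij: "i < k" "j < k"
    show "(x i < z j \<longleftrightarrow> ?x i < ?z j) \<and> (x i < w j \<longleftrightarrow> ?x i < ?w j) \<and>
      (y i < z j \<longleftrightarrow> ?y i < ?z j) \<and> (y i < w j \<longleftrightarrow> ?y i < ?w j)"
      using block[OF ij(1)] block[OF ij(2)] yx[of i j] zw[of i j] yx[of j i] zw[of j i] ij
      by (cases i j rule: linorder_cases) auto
  qed
qed simp_all

theorem corollary8p3: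
  fixes P :: mv_word and k :: nat
  assumes "k \<ge> 2"
  shows "(delta0 P \<noteq> -1 \<or> delta1 P \<noteq> -1 \<longrightarrow> int (folding_count P k) = 0) \<and>
         (delta0 P = -1 \<and> delta1 P = -1 \<and> tau P = -1 \<longrightarrow>
            int (folding_count P k) = 1) \<and>
         (delta0 P = -1 \<and> delta1 P = -1 \<and> tau P = 1 \<and> rho P = 1 \<longrightarrow>
            int (folding_count P k) = 6 * int k - 5) \<and>
         (delta0 P = -1 \<and> delta1 P = -1 \<and> tau P = 1 \<and> rho P = -1 \<longrightarrow>
            int (folding_count P k) = 4 * int k - 3)"
proof (cases "delta0 P = -1 \<and> delta1 P = -1")
  case False
  then have "foldings P k = {}" by (auto simp: foldings_def locally_flat_foldable_iff[OF assms])
  with False show ?thesis by (auto simp: folding_count_def)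
next
  case True
  note reps = folding_count_parallel[OF assms] folding_count_antiparallel[OF assms]
    folding_count_parallel_monotone[OF assms] folding_count_antiparallel_monotone[OF assms]
  \<comment> \<open>Exchanging the rows replaces \<open>u\<close>, \<open>v\<close> by their
    opposites and keeps \<open>h\<close>; taking all opposites adjusts \<open>h\<close>. Together
    they reach a representative with \<open>h\<close> and \<open>u\<close> equal to
    \<open>Mountain\<close>.\<close>
  have parallel: "folding_count (Word h h u v (opposite u) (opposite v)) k = (if u = v then 6 * k - 5 else 1)"
    for h u v
    using reps(1,3) folding_count_swap_rows[OF assms] folding_count_opposite[OF assms]
    by (cases h; cases u; cases v) (metis opposite.simps mv.distinct)+
  \<comment> \<open>Exchanging the columns replaces \<open>h\<close> by its opposite and keeps
    \<open>u\<close>, \<open>v\<close>; taking all opposites adjusts \<open>u\<close>.\<close>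
  have antiparallel: "folding_count (Word h (opposite h) u v u v) k = (if u = v then 4 * k - 3 else 1)"
    for h u v
    using reps(2,4) folding_count_swap_columns[OF assms] folding_count_opposite[OF assms]
    by (cases h; cases u; cases v) (metis opposite.simps mv.distinct)+
  obtain h0 h1 u0 u1 l0 l1 where P: "P = Word h0 h1 u0 u1 l0 l1" by (cases P)
  show ?thesis
  proof (cases "h0 = h1")
    case h: True
    \<comment> \<open>With both deltas equal to -1, \<open>rho = 1\<close> makes the upper and lower
      edges of a column pair carry opposite labels, and \<open>rho = -1\<close> makes them carry
      equal ones.\<close>
    then have "l0 = opposite u0" "l1 = opposite u1"
      using True by (cases h1; cases u0; cases u1; cases l0; cases l1; simp add: P)+
    with P h have "P = Word h1 h1 u0 u1 (opposite u0) (opposite u1)" by simp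
    then show ?thesis using True assms parallel[of h1 u0 u1]
      by (cases h1; cases u0; cases u1) (simp_all add: of_nat_diff)
  next
    case h: False
    then have "h1 = opposite h0" "l0 = u0" "l1 = u1"
      using True by (cases h0; cases h1; cases u0; cases u1; cases l0; cases l1; simp add: P)+
    with P have "P = Word h0 (opposite h0) u0 u1 u0 u1" by simp
    then show ?thesis using True assms antiparallel[of h0 u0 u1]
      by (cases h0; cases u0; cases u1) (simp_all add: of_nat_diff)
  qed
qed

end
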